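(* Let $\bullet$ be either $*$ or $\rho$, and suppose $U\subset{}^{\bullet}\mathbb R^k$, $V\subset{}^{\bullet}\mathbb R^l$ and $W\subset{}^{\bullet}\mathbb R^m$ are open subsets. Then the composition of maps induces a pairing ${}^{\bullet}C^\infty(V,W)\times{}^{\bullet}C^\infty(U,V)\xrightarrow{\circ}{}^{\bullet}C^\infty(U,W)$ which is subject to the chain rule $$J_{g\circ f}(x)=J_g(f(x))\,J_f(x)\qquad(f\in{}^{\bullet}C^\infty(U,V),\ g\in{}^{\bullet}C^\infty(V,W),\ x\in U),$$ where $J_f(x)=(\partial_jf_i(x))_{i,j}$ is the Jacobian matrix of $f=(f_1,\dots,f_l)$ at $x$ and similarly for $J_g$ and $J_{g\circ f}$.
   Context: Numbers. $\mathbb N$ is the set of nonnegative integers, $\mathcal U$ a fixed free ultrafilter on $\mathbb N$; "$P(n)$ a.e." means $\{n: P(n)\}\in\mathcal U$. ${}^*\mathbb R=\mathbb R^{\mathbb N}/\{(x_n): x_n=0\text{ a.e.}\}$ ordered by $[a_n]\le[b_n]$ iff $a_n\le b_n$ a.e.; ${}^*\mathbb N$ is the image of $\mathbb N^{\mathbb N}$; $\rho=[1/n]$. ${}^{\rho}\mathbf M({}^*\mathbb R)=\{x:\exists c\in{}^*\mathbb N,\ |x|\le\rho^{-c}\}$, ${}^{\rho}\mathbf N({}^*\mathbb R)=\{x:\forall d\in{}^*\mathbb N,\ |x|\le\rho^{d}\}$, ${}^{\rho}\mathbb R={}^{\rho}\mathbf M({}^*\mathbb R)/{}^{\rho}\mathbf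 N({}^*\mathbb R)$. ${}^{*}\mathbf M(\mathbb R^{\mathbb N})=\mathbb R^{\mathbb N}$ and ${}^{\rho}\mathbf M(\mathbb R^{\mathbb N})=\{(x_n):\exists (c_n)\in\mathbb N^{\mathbb N},\ |x_n|\le n^{c_n}\text{ a.e.}\}$. $[x_n]$ denotes the class of a net. Topology. ${}^{\bullet}\mathbb R^k$ has the topology with basis the sets $[V_n]=\{[x_n]:(x_n)\in\prod_nV_n\cap{}^{\bullet}\mathbf M(\mathbb R^{\mathbb N})^k\}$, $V_n\subset\mathbb R^k$ open. Calculus. Case $*$: for $U\subset{}^*\mathbb R^k$ open, ${}^*C^\infty(U,{}^*\mathbb R)$ is the set of $f\colon U\to{}^*\mathbb R$ such that each $x\in U$ has a neighbourhood $V=[V_n]\subset U$ ($V_n$ open) and $C^\infty$ functions $g_n\colon V_n\to\mathbb R$ with $f([y_n])=[g_n(y_n)]$ for all $[y_n]\in V$, $y_n\in V_n$; $\partial_if([x_n])=[\partial_ig_n(x_n)]$. Case $\rho$: let $q\colon{}^{\rho}\mathbf M({}^*\mathbb R)\to{}^{\rho}\mathbb R$ be the projection; for $U\subset{}^{\rho}\mathbb R^k$ open put $U'=(q^k)^{-1}(U)$, define ${}^*C^\infty(U',{}^*\mathbb R)$ and $\partial_i$ in the same way (with nets in ${}^{\rho}\mathbf M(\mathbb R^{\mathbb N})^k$), for $\mathbf L=\mathbf M,\mathbf N$ let ${}^{\rho}\mathbf L({}^*C^\infty(U',{}^*\mathbb R))$ be the set of $\phi$ with $D^\alpha\phi(y)\in{}^{\rho}\mathbf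 L({}^*\mathbb R)$ for all $\alpha\in\mathbb N^k$, $y\in U'$, and put ${}^{\rho}C^\infty(U,{}^{\rho}\mathbb R)={}^{\rho}\mathbf M({}^*C^\infty(U',{}^*\mathbb R))/{}^{\rho}\mathbf N({}^*C^\infty(U',{}^*\mathbb R))$. A class $[\phi]$ is regarded as the function $U\to{}^{\rho}\mathbb R$, $x\mapsto[\phi(y)]$ with $q^k(y)=x$, and $\partial_i[\phi]=[\partial_i\phi]$. For open $U\subset{}^{\bullet}\mathbb R^k$, $V\subset{}^{\bullet}\mathbb R^l$, ${}^{\bullet}C^\infty(U,V)$ is the set of maps $f=(f_1,\dots,f_l)\colon U\to{}^{\bullet}\mathbb R^l$ with image in $V$ and all $f_i\in{}^{\bullet}C^\infty(U,{}^{\bullet}\mathbb R)$. *)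

theory Defs
  imports "HOL-Analysis.Analysis"
begin

section \<open>The free ultrafilter\<close>

definition free_ultrafilter :: "nat filter \<Rightarrow> bool" where
  "free_ultrafilter F \<longleftrightarrow> F \<noteq> bot \<and>
     (\<forall>P. eventually P F \<or> eventually (\<lambda>n. \<not> P n) F) \<and>
     (\<forall>m. eventually (\<lambda>n. n \<noteq> m) F)"

lemma free_ultrafilter_exists: "\<exists>F. free_ultrafilter F"
proof -
  define A :: "nat filter set" where "A = {F. F \<noteq> bot \<and> F \<le> sequentially}"
  have "\<exists>F\<in>A. \<forall>G\<in>A. G \<le> F \<longrightarrow> G = F"
  proof (rule predicate_Zorn[of A "\<lambda>F G. G \<le> F"])
    show "partial_order_on A (relation_of (\<lambda>F G. G \<le> F) A)"
      by (auto simp: partial_order_on_def preorder_on_def refl_on_def trans_def antisym_def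
          relation_of_def)
  next
    fix C assume C: "C \<in> Chains (relation_of (\<lambda>F G. G \<le> F) A)"
    then have CA: "C \<subseteq> A" and ch: "\<And>F G. F \<in> C \<Longrightarrow> G \<in> C \<Longrightarrow> F \<le> G \<or> G \<le> F"
      by (auto simp: Chains_def relation_of_def)
    show "\<exists>u\<in>A. \<forall>F\<in>C. u \<le> F"
    proof (cases "C = {}")
      case True
      have "sequentially \<in> A" by (simp add: A_def)
      with True show ?thesis by blast
    next
      case False
      then have ev: "eventually P (Inf C) \<longleftrightarrow> (\<exists>F\<in>C. eventually P F)" for P
        by (rule eventually_Inf_base) (use ch in \<open>meson inf.bounded_iff order_refl le_inf_iff\<close>)
      have "Inf C \<noteq> bot"
        using ev[of "\<lambda>_. False"] CA by (auto simp: A_def eventually_False)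
      moreover obtain F where "F \<in> C" using False by blast
      then have "Inf C \<le> sequentially"
        using CA by (auto simp: A_def intro: Inf_lower2)
      ultimately have "Inf C \<in> A" by (simp add: A_def)
      then show ?thesis by (blast intro: Inf_lower)
    qed
  qed
  then obtain F where F: "F \<noteq> bot" "F \<le> sequentially"
    and max: "\<And>G. G \<noteq> bot \<Longrightarrow> G \<le> F \<Longrightarrow> G = F"
    unfolding A_def by (auto intro: order_trans)
  have "eventually P F \<or> eventually (\<lambda>n. \<not> P n) F" for P
  proof (rule disjCI)
    assume "\<not> eventually (\<lambda>n. \<not> P n) F"
    then have "inf F (principal {n. P n}) \<noteq> bot"
      by (simp add: trivial_limit_def eventually_inf_principal)
    then have "inf F (principal {n. P n}) = F" by (rule max) simp
    then show "eventually P F"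
      using eventually_inf_principal[of P F "{n. P n}"] by simp
  qed
  moreover have "eventually (\<lambda>n. n \<noteq> m) F" for m
  proof -
    have "eventually (\<lambda>n. n \<noteq> m) sequentially"
      using eventually_gt_at_top[of m] by eventually_elim auto
    then show ?thesis using F(2) by (simp add: filter_leD)
  qed
  ultimately show ?thesis using F(1) by (auto simp: free_ultrafilter_def)
qed

definition ultra :: "nat filter" where
  "ultra = (SOME F. free_ultrafilter F)"

lemma free_ultrafilter_ultra: "free_ultrafilter ultra"
  unfolding ultra_def using free_ultrafilter_exists by (rule someI_ex)

lemma ultra_neq_bot: "ultra \<noteq> bot"
  and ultra_cases: "eventually P ultra \<or> eventually (\<lambda>n. \<not> P n) ultra"
  and ultra_free: "eventually (\<lambda>n. n \<noteq> m) ultra"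
  using free_ultrafilter_ultra by (auto simp: free_ultrafilter_def)

lemma ultra_disj:
  "eventually (\<lambda>n. P n \<or> Q n) ultra \<Longrightarrow> eventually P ultra \<or> eventually Q ultra"
proof (rule disjCI)
  assume "eventually (\<lambda>n. P n \<or> Q n) ultra" "\<not> eventually Q ultra"
  moreover from this(2) have "eventually (\<lambda>n. \<not> Q n) ultra" using ultra_cases[of Q] by simp
  ultimately show "eventually P ultra" by (auto elim: eventually_elim2)
qed

lemma ultra_ge: "eventually (\<lambda>n. m \<le> n) ultra"
proof (induction m)
  case (Suc m)
  then show ?case using ultra_free[of m] by eventually_elim auto
qed simp

section \<open>Nonstandard reals\<close>

quotient_type star_real = "nat \<Rightarrow> real" / "\<lambda>x y. \<forall>\<^sub>F n in ultra. x n = y n"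
  morphisms rep_star star_cls
proof (rule equivpI)
  show "transp (\<lambda>x y :: nat \<Rightarrow> real. \<forall>\<^sub>F n in ultra. x n = y n)"
    by (rule transpI) (erule (1) eventually_elim2, simp)
qed (auto simp: reflp_def symp_def eq_commute)

lemma star_cls_cases: obtains x where "a = star_cls x"
  by (induction a rule: star_real.abs_induct) blast

instantiation star_real :: linordered_idom
begin

lift_definition zero_star_real :: star_real is "\<lambda>_. 0" .
lift_definition one_star_real :: star_real is "\<lambda>_. 1" .
lift_definition plus_star_real :: "star_real \<Rightarrow> star_real \<Rightarrow> star_real" is "\<lambda>x y n. x n + y n"
  by (erule (1) eventually_elim2, simp)
lift_definition minus_star_real :: "star_real \<Rightarrow> star_real \<Rightarrow> star_real" is "\<lambda>x y n. x n - y n"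
  by (erule (1) eventually_elim2, simp)
lift_definition times_star_real :: "star_real \<Rightarrow> star_real \<Rightarrow> star_real" is "\<lambda>x y n. x n * y n"
  by (erule (1) eventually_elim2, simp)
lift_definition uminus_star_real :: "star_real \<Rightarrow> star_real" is "\<lambda>x n. - x n"
  by (erule eventually_mono, simp)
lift_definition abs_star_real :: "star_real \<Rightarrow> star_real" is "\<lambda>x n. \<bar>x n\<bar>"
  by (erule eventually_mono, simp)
lift_definition sgn_star_real :: "star_real \<Rightarrow> star_real" is "\<lambda>x n. sgn (x n)"
  by (erule eventually_mono, simp)
lift_definition less_eq_star_real :: "star_real \<Rightarrow> star_real \<Rightarrow> bool"
  is "\<lambda>x y. \<forall>\<^sub>F n in ultra. x n \<le> y n"
proof -
  fix a b c d :: "nat \<Rightarrow> real"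
  assume "\<forall>\<^sub>F n in ultra. a n = b n" "\<forall>\<^sub>F n in ultra. c n = d n"
  then have "\<forall>\<^sub>F n in ultra. (a n \<le> c n) = (b n \<le> d n)" by eventually_elim simp
  then show "(\<forall>\<^sub>F n in ultra. a n \<le> c n) = (\<forall>\<^sub>F n in ultra. b n \<le> d n)"
    by (rule eventually_subst)
qed
definition less_star_real :: "star_real \<Rightarrow> star_real \<Rightarrow> bool"
  where "less_star_real x y \<longleftrightarrow> x \<le> y \<and> \<not> y \<le> x"

lemma star_less_cls: "star_cls x < star_cls y \<longleftrightarrow> (\<forall>\<^sub>F n in ultra. x n < y n)"
proof -
  have "(\<forall>\<^sub>F n in ultra. x n \<le> y n) \<and> \<not> (\<forall>\<^sub>F n in ultra. y n \<le> x n)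
        \<longleftrightarrow> (\<forall>\<^sub>F n in ultra. x n < y n)" (is "?L \<longleftrightarrow> ?R")
  proof
    assume ?L
    then show ?R using ultra_cases[of "\<lambda>n. y n \<le> x n"] by (auto simp: not_le)
  next
    assume R: ?R
    have "\<not> (\<forall>\<^sub>F n in ultra. y n \<le> x n)"
    proof
      assume "\<forall>\<^sub>F n in ultra. y n \<le> x n"
      with R have "\<forall>\<^sub>F n in ultra. False" by eventually_elim simp
      then show False using ultra_neq_bot by (simp add: eventually_False)
    qed
    with R show ?L by (auto elim: eventually_mono)
  qed
  then show ?thesis unfolding less_star_real_def by (simp add: less_eq_star_real.abs_eq)
qed

instance
proof
  fix a b c :: star_real
  show "a + b + c = a + (b + c)" by transfer (simp add: add.assoc)
  show "a + b = b + a" by transfer (simp add: add.commute)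
  show "0 + a = a" by transfer simp
  show "- a + a = 0" by transfer simp
  show "a - b = a + - b" by transfer simp
  show "a * b * c = a * (b * c)" by transfer (simp add: mult.assoc)
  show "a * b = b * a" by transfer (simp add: mult.commute)
  show "1 * a = a" by transfer simp
  show "(a + b) * c = a * c + b * c" by transfer (simp add: algebra_simps)
  show "(0::star_real) \<noteq> 1" by transfer (simp add: ultra_neq_bot)
  show "a < b \<longleftrightarrow> a \<le> b \<and> \<not> b \<le> a" by (rule less_star_real_def)
  show "a \<le> a" by transfer simp
  show "a \<le> c" if "a \<le> b" "b \<le> c" using that by transfer (erule (1) eventually_elim2, simp)
  show "a = b" if "a \<le> b" "b \<le> a" using that by transfer (erule (1) eventually_elim2, simp)
  show "a \<le> b \<or> b \<le> a" by transfer (rule ultra_disj, simp add: linear)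
  show "c + a \<le> c + b" if "a \<le> b" using that by transfer (erule eventually_mono, simp)
  show "\<bar>a\<bar> = (if a < 0 then - a else a)"
  proof -
    obtain x where a: "a = star_cls x" by (meson star_cls_cases)
    have "\<not> a < 0 \<Longrightarrow> \<forall>\<^sub>F n in ultra. 0 \<le> x n"
      using ultra_cases[of "\<lambda>n. x n < 0"]
      by (auto simp: a zero_star_real_def star_less_cls not_less)
    then show ?thesis
      by (auto simp: a zero_star_real_def star_less_cls abs_star_real.abs_eq
          uminus_star_real.abs_eq star_real.abs_eq_iff elim: eventually_mono
          dest!: eventually_mono[of "\<lambda>n. 0 \<le> x n" _ "\<lambda>n. \<bar>x n\<bar> = x n"])
  qed
  show "sgn a = (if a = 0 then 0 else if 0 < a then 1 else - 1)"
  proof -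
    obtain x where a: "a = star_cls x" by (meson star_cls_cases)
    have "a \<noteq> 0 \<Longrightarrow> \<not> 0 < a \<Longrightarrow> \<forall>\<^sub>F n in ultra. x n < 0"
      using ultra_cases[of "\<lambda>n. x n = 0"] ultra_cases[of "\<lambda>n. 0 < x n"]
      by (auto simp: a zero_star_real_def star_less_cls star_real.abs_eq_iff
          elim: eventually_elim2)
    then show ?thesis
      by (auto simp: a zero_star_real_def one_star_real_def star_less_cls sgn_star_real.abs_eq
          uminus_star_real.abs_eq star_real.abs_eq_iff elim: eventually_mono
          dest!: eventually_mono[of "\<lambda>n. x n < 0" _ "\<lambda>n. sgn (x n) = - 1"])
  qed
  show "a + b - a = b" by transfer simp
  show "a - b - c = a - (b + c)" by transfer (simp add: algebra_simps)
  show "0 * a = 0" by transfer simp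
  show "a * 0 = 0" by transfer simp
  show "c * a < c * b" if "a < b" "0 < c"
  proof -
    obtain x y z where "a = star_cls x" "b = star_cls y" "c = star_cls z"
      by (meson star_cls_cases)
    with that show ?thesis
      by (auto simp: zero_star_real_def star_less_cls times_star_real.abs_eq
          elim: eventually_elim2)
  qed
qed

end

definition star_nat :: "star_real set" where
  "star_nat = {star_cls (\<lambda>n. real (c n)) | c. True}"

lift_definition star_powr :: "star_real \<Rightarrow> star_real \<Rightarrow> star_real" is "\<lambda>x y n. x n powr y n"
  by (erule (1) eventually_elim2, simp)

definition rho :: star_real where
  "rho = star_cls (\<lambda>n. 1 / real n)"

section \<open>Asymptotic numbers\<close>

text \<open>The exponents \<open>c\<close> and \<open>d\<close> range over all hypernaturals, including the infinite ones, and
  \<open>star_powr\<close> is the termwise power. The junk value of \<open>1 / real n\<close> at \<open>n = 0\<close> is irrelevant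
  because the ultrafilter is free.\<close>

definition rho_M :: "star_real set" where
  "rho_M = {x. \<exists>c\<in>star_nat. \<bar>x\<bar> \<le> star_powr rho (- c)}"

definition rho_N :: "star_real set" where
  "rho_N = {x. \<forall>d\<in>star_nat. \<bar>x\<bar> \<le> star_powr rho d}"

lemma star_nat_add: "c \<in> star_nat \<Longrightarrow> d \<in> star_nat \<Longrightarrow> c + d \<in> star_nat"
  unfolding star_nat_def
  by (auto simp: plus_star_real.abs_eq simp flip: of_nat_add)

lemma star_nat_0: "0 \<in> star_nat" and star_nat_1: "1 \<in> star_nat"
  unfolding star_nat_def zero_star_real_def one_star_real_def
  by (auto intro: exI[of _ "\<lambda>_. 0"] exI[of _ "\<lambda>_. 1"])

lemma star_nat_nonneg: "c \<in> star_nat \<Longrightarrow> 0 \<le> c"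
  unfolding star_nat_def by (auto simp: zero_star_real_def less_eq_star_real.abs_eq)

lemma rho_powr_pos: "0 < star_powr rho c"
proof -
  obtain x where c: "c = star_cls x" by (meson star_cls_cases)
  show ?thesis
    using ultra_free[of 0]
    by (auto simp: c rho_def star_powr.abs_eq zero_star_real_def star_less_cls
        elim: eventually_mono)
qed

lemma rho_powr_add: "star_powr rho (c + d) = star_powr rho c * star_powr rho d"
  proof -
  obtain x y where "c = star_cls x" "d = star_cls y" by (meson star_cls_cases)
  then show ?thesis
    by (simp add: rho_def star_powr.abs_eq plus_star_real.abs_eq times_star_real.abs_eq powr_add)
qed

lemma rho_powr_0: "star_powr rho 0 = 1"
  unfolding rho_def zero_star_real_def one_star_real_def star_powr.abs_eq star_real.abs_eq_iff
  using ultra_free[of 0] by eventually_elim simp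

lemma rho_powr_antimono:
  assumes "c \<le> d" shows "star_powr rho d \<le> star_powr rho c"
proof -
  obtain x y where cd: "c = star_cls x" "d = star_cls y" by (meson star_cls_cases)
  from assms have "\<forall>\<^sub>F n in ultra. x n \<le> y n" by (simp add: cd less_eq_star_real.abs_eq)
  with ultra_ge[of 1] have "\<forall>\<^sub>F n in ultra. (1 / real n) powr y n \<le> (1 / real n) powr x n"
    by eventually_elim (rule powr_mono', auto)
  then show ?thesis by (simp add: cd rho_def star_powr.abs_eq less_eq_star_real.abs_eq)
qed

lemma two_rho_le: "2 * star_powr rho 1 \<le> 1"
proof -
  have "(2::star_real) = star_cls (\<lambda>_. 2)"
    unfolding one_add_one[symmetric] one_star_real_def plus_star_real.abs_eq by simp
  moreover have "\<forall>\<^sub>F n in ultra. 2 * (1 / real n) powr 1 \<le> 1"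
    using ultra_ge[of 2] by eventually_elim auto
  ultimately show ?thesis
    by (simp only: rho_def one_star_real_def star_powr.abs_eq times_star_real.abs_eq
        less_eq_star_real.abs_eq)
qed

lemma rho_N_0: "0 \<in> rho_N"
  unfolding rho_N_def using rho_powr_pos by (auto intro: less_imp_le)

lemma rho_N_uminus: "x \<in> rho_N \<Longrightarrow> - x \<in> rho_N"
  by (simp add: rho_N_def)

lemma rho_N_add:
  assumes "x \<in> rho_N" "y \<in> rho_N" shows "x + y \<in> rho_N"
  unfolding rho_N_def
proof safe
  fix d assume "d \<in> star_nat"
  then have d: "d + 1 \<in> star_nat" by (intro star_nat_add star_nat_1)
  have "\<bar>x + y\<bar> \<le> star_powr rho (d + 1) + star_powr rho (d + 1)"
    using assms d by (intro order_trans[OF abs_triangle_ineq] add_mono) (auto simp: rho_N_def)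
  also have "\<dots> = star_powr rho d * (2 * star_powr rho 1)"
    by (simp add: rho_powr_add algebra_simps)
  also have "\<dots> \<le> star_powr rho d * 1"
    using two_rho_le rho_powr_pos[of d] by (intro mult_left_mono) auto
  finally show "\<bar>x + y\<bar> \<le> star_powr rho d" by simp
qed

lemma rho_N_mult:
  assumes "x \<in> rho_M" "y \<in> rho_N" shows "x * y \<in> rho_N"
  unfolding rho_N_def
proof safe
  fix d assume d: "d \<in> star_nat"
  obtain c where c: "c \<in> star_nat" "\<bar>x\<bar> \<le> star_powr rho (- c)"
    using assms(1) by (auto simp: rho_M_def)
  have "\<bar>x * y\<bar> \<le> star_powr rho (- c) * star_powr rho (c + d)"
    unfolding abs_mult using assms(2) c d rho_powr_pos
    by (intro mult_mono) (auto simp: rho_N_def star_nat_add intro: less_imp_le)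
  also have "\<dots> = star_powr rho d" by (simp flip: rho_powr_add)
  finally show "\<bar>x * y\<bar> \<le> star_powr rho d" .
qed

lemma rho_M_0: "0 \<in> rho_M" and rho_M_1: "1 \<in> rho_M"
  unfolding rho_M_def using star_nat_0 rho_powr_0 by force+

lemma rho_M_uminus: "x \<in> rho_M \<Longrightarrow> - x \<in> rho_M"
  by (simp add: rho_M_def)

lemma rho_M_add:
  assumes "x \<in> rho_M" "y \<in> rho_M" shows "x + y \<in> rho_M"
proof -
  obtain c d where c: "c \<in> star_nat" "\<bar>x\<bar> \<le> star_powr rho (- c)"
    and d: "d \<in> star_nat" "\<bar>y\<bar> \<le> star_powr rho (- d)"
    using assms by (auto simp: rho_M_def)
  let ?e = "c + d + 1"
  have 1: "star_powr rho (- c) \<le> star_powr rho (- (c + d))"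
    and 2: "star_powr rho (- d) \<le> star_powr rho (- (c + d))"
    using star_nat_nonneg[OF c(1)] star_nat_nonneg[OF d(1)]
    by (auto intro!: rho_powr_antimono)
  have "\<bar>x + y\<bar> \<le> 2 * star_powr rho (- (c + d))"
    using abs_triangle_ineq[of x y] c(2) d(2) 1 2 by linarith
  also have "\<dots> = (2 * star_powr rho 1) * star_powr rho (- ?e)"
    by (simp add: mult.assoc flip: rho_powr_add)
  also have "\<dots> \<le> 1 * star_powr rho (- ?e)"
    using two_rho_le rho_powr_pos by (intro mult_right_mono) (auto intro: less_imp_le)
  finally have "\<bar>x + y\<bar> \<le> star_powr rho (- ?e)" unfolding mult_1_left .
  then show ?thesis
    using star_nat_add[OF star_nat_add[OF c(1) d(1)] star_nat_1]
    unfolding rho_M_def by blast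
qed

lemma rho_M_mult:
  assumes "x \<in> rho_M" "y \<in> rho_M" shows "x * y \<in> rho_M"
proof -
  obtain c d where c: "c \<in> star_nat" "\<bar>x\<bar> \<le> star_powr rho (- c)"
    and d: "d \<in> star_nat" "\<bar>y\<bar> \<le> star_powr rho (- d)"
    using assms by (auto simp: rho_M_def)
  have "\<bar>x * y\<bar> \<le> star_powr rho (- c) * star_powr rho (- d)"
    unfolding abs_mult using c d rho_powr_pos
    by (intro mult_mono) (auto intro: less_imp_le)
  also have "\<dots> = star_powr rho (- (c + d))" by (simp flip: rho_powr_add)
  finally show ?thesis using star_nat_add[OF c(1) d(1)] unfolding rho_M_def by blast
qed

lemma one_notin_rho_N: "1 \<notin> rho_N"
proof
  assume "1 \<in> rho_N"
  then have "1 \<le> star_powr rho 1" using star_nat_1 by (auto simp: rho_N_def)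
  with two_rho_le rho_powr_pos[of 1] show False by linarith
qed

quotient_type rho_real = star_real /
  partial: "\<lambda>x y. x \<in> rho_M \<and> y \<in> rho_M \<and> x - y \<in> rho_N"
  morphisms rep_rho rho_cls
proof (rule part_equivpI)
  show "\<exists>x. x \<in> rho_M \<and> x \<in> rho_M \<and> x - x \<in> rho_N"
    using rho_M_0 rho_N_0 by auto
  show "symp (\<lambda>x y. x \<in> rho_M \<and> y \<in> rho_M \<and> x - y \<in> rho_N)"
    using rho_N_uminus by (fastforce simp: symp_def)
  show "transp (\<lambda>x y. x \<in> rho_M \<and> y \<in> rho_M \<and> x - y \<in> rho_N)"
    using rho_N_add by (fastforce simp: transp_def)
qed

instantiation rho_real :: comm_ring_1
begin

lift_definition zero_rho_real :: rho_real is 0 by (simp add: rho_M_0 rho_N_0)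
lift_definition one_rho_real :: rho_real is 1 by (simp add: rho_M_1 rho_N_0)
lift_definition plus_rho_real :: "rho_real \<Rightarrow> rho_real \<Rightarrow> rho_real" is "(+)"
  by (metis rho_M_add rho_N_add add_diff_add)
lift_definition uminus_rho_real :: "rho_real \<Rightarrow> rho_real" is uminus
  using rho_M_uminus rho_N_uminus by fastforce
lift_definition minus_rho_real :: "rho_real \<Rightarrow> rho_real \<Rightarrow> rho_real" is "(-)"
proof -
  fix a b c d :: star_real
  assume h: "a \<in> rho_M \<and> b \<in> rho_M \<and> a - b \<in> rho_N" "c \<in> rho_M \<and> d \<in> rho_M \<and> c - d \<in> rho_N"
  have "(a - c) - (b - d) = (a - b) + - (c - d)" by simp
  then show "a - c \<in> rho_M \<and> b - d \<in> rho_M \<and> (a - c) - (b - d) \<in> rho_N"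
    using h by (metis rho_M_add rho_M_uminus rho_N_add rho_N_uminus add_uminus_conv_diff)
qed
lift_definition times_rho_real :: "rho_real \<Rightarrow> rho_real \<Rightarrow> rho_real" is "(*)"
proof -
  fix a b c d :: star_real
  assume h: "a \<in> rho_M \<and> b \<in> rho_M \<and> a - b \<in> rho_N" "c \<in> rho_M \<and> d \<in> rho_M \<and> c - d \<in> rho_N"
  have "a * c - b * d = c * (a - b) + b * (c - d)" by (simp add: algebra_simps)
  then show "a * c \<in> rho_M \<and> b * d \<in> rho_M \<and> a * c - b * d \<in> rho_N"
    using h by (auto intro: rho_M_mult rho_N_add rho_N_mult)
qed

instance
proof
  fix a b c :: rho_real
  show "a + b + c = a + (b + c)"
    by transfer (auto simp: add.assoc rho_M_add rho_N_0)
  show "a + b = b + a" by transfer (auto simp: add.commute rho_M_add rho_N_0)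
  show "0 + a = a" by transfer (auto simp: rho_N_0)
  show "- a + a = 0" by transfer (auto simp: rho_N_0 rho_M_0)
  show "a - b = a + - b"
    by transfer (auto simp: rho_N_0 intro: rho_M_add[of _ "- _", simplified] rho_M_uminus)
  show "a * b * c = a * (b * c)"
    by transfer (auto simp: mult.assoc rho_M_mult rho_N_0)
  show "a * b = b * a" by transfer (auto simp: mult.commute rho_M_mult rho_N_0)
  show "1 * a = a" by transfer (auto simp: rho_N_0)
  show "(a + b) * c = a * c + b * c"
    by transfer (auto simp: algebra_simps rho_M_mult rho_M_add rho_N_0)
  show "(0::rho_real) \<noteq> 1"
    by transfer (use one_notin_rho_N rho_N_uminus in fastforce)
qed

end

section \<open>Nets, internal sets and topologies\<close>

text \<open>In the definitions below, the parameter \<open>M\<close> is the set of admissible scalar nets: all of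
  \<open>UNIV\<close> in the case \<open>*\<close>, and \<open>rho_nets\<close> in the case \<open>\<rho>\<close>.\<close>

definition rho_nets :: "(nat \<Rightarrow> real) set" where
  "rho_nets = {x. \<exists>c :: nat \<Rightarrow> nat. \<forall>\<^sub>F n in ultra. \<bar>x n\<bar> \<le> real n ^ c n}"

text \<open>\<open>\<Prod>\<^sub>n V n \<inter> M\<^sup>k\<close>, identifying nets of vectors with vectors of nets:\<close>

definition nets :: "(nat \<Rightarrow> real) set \<Rightarrow> (nat \<Rightarrow> (real ^ 'k) set) \<Rightarrow> (nat \<Rightarrow> real ^ 'k) set" where
  "nets M V = {x. (\<forall>n. x n \<in> V n) \<and> (\<forall>i. (\<lambda>n. x n $ i) \<in> M)}"

definition star_vec :: "(nat \<Rightarrow> real ^ 'k) \<Rightarrow> star_real ^ 'k" where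
  "star_vec x = (\<chi> i. star_cls (\<lambda>n. x n $ i))"

definition rho_vec :: "star_real ^ 'k \<Rightarrow> rho_real ^ 'k" where
  "rho_vec y = (\<chi> i. rho_cls (y $ i))"

definition star_box :: "(nat \<Rightarrow> real) set \<Rightarrow> (nat \<Rightarrow> (real ^ 'k) set) \<Rightarrow> (star_real ^ 'k) set" where
  "star_box M V = star_vec ` nets M V"

definition star_open :: "(star_real ^ 'k) set \<Rightarrow> bool" where
  "star_open = arbitrary union_of (\<lambda>B. \<exists>V. (\<forall>n. open (V n)) \<and> B = star_box UNIV V)"

definition rho_open :: "(rho_real ^ 'k) set \<Rightarrow> bool" where
  "rho_open = arbitrary union_of (\<lambda>B. \<exists>V. (\<forall>n. open (V n)) \<and> B = rho_vec ` star_box rho_nets V)"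

section \<open>Smooth functions on Euclidean open sets\<close>

text \<open>Only used for differentiable \<open>g\<close>, whose \<open>i\<close>-th partial derivative is the Frechet derivative
  applied to the \<open>i\<close>-th unit vector.\<close>

definition partial_deriv :: "'k::finite \<Rightarrow> (real ^ 'k \<Rightarrow> real) \<Rightarrow> real ^ 'k \<Rightarrow> real" where
  "partial_deriv i g x = frechet_derivative g (at x) (axis i 1)"

fun C_on :: "nat \<Rightarrow> (real ^ 'k) set \<Rightarrow> (real ^ 'k \<Rightarrow> real) \<Rightarrow> bool" where
  "C_on 0 V g \<longleftrightarrow> continuous_on V g"
| "C_on (Suc r) V g \<longleftrightarrow> (\<forall>x\<in>V. g differentiable (at x)) \<and> (\<forall>i. C_on r V (partial_deriv i g))"

definition C_infinity_on :: "(real ^ 'k) set \<Rightarrow> (real ^ 'k \<Rightarrow> real) \<Rightarrow> bool" where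
  "C_infinity_on V g \<longleftrightarrow> (\<forall>r. C_on r V g)"

section \<open>Smooth functions on nonstandard domains\<close>

definition represents :: "(nat \<Rightarrow> real) set \<Rightarrow> (star_real ^ 'k) set \<Rightarrow> (star_real ^ 'k \<Rightarrow> star_real) \<Rightarrow>
    (nat \<Rightarrow> (real ^ 'k) set) \<Rightarrow> (nat \<Rightarrow> real ^ 'k \<Rightarrow> real) \<Rightarrow> bool" where
  "represents M U f V g \<longleftrightarrow>
     (\<forall>n. open (V n) \<and> C_infinity_on (V n) (g n)) \<and> star_box M V \<subseteq> U \<and>
     (\<forall>y\<in>nets M V. f (star_vec y) = star_cls (\<lambda>n. g n (y n)))"

text \<open>Functions with domain \<open>U\<close> are total functions whose values outside \<open>U\<close> are irrelevant.\<close>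

definition star_smooth :: "(nat \<Rightarrow> real) set \<Rightarrow> (star_real ^ 'k) set \<Rightarrow> (star_real ^ 'k \<Rightarrow> star_real) set"
  where "star_smooth M U = {f. \<forall>x\<in>U. \<exists>V g. represents M U f V g \<and> x \<in> star_box M V}"

text \<open>The value does not depend on the choice of \<open>V\<close>, \<open>g\<close> and \<open>y\<close> when \<open>f\<close> is smooth on \<open>U\<close>
  and \<open>x \<in> U\<close>.\<close>

definition star_partial :: "(nat \<Rightarrow> real) set \<Rightarrow> (star_real ^ 'k) set \<Rightarrow> 'k \<Rightarrow>
    (star_real ^ 'k \<Rightarrow> star_real) \<Rightarrow> star_real ^ 'k \<Rightarrow> star_real" where
  "star_partial M U i f x = (THE d. \<exists>V g. represents M U f V g \<and>
     (\<exists>y\<in>nets M V. x = star_vec y \<and> d = star_cls (\<lambda>n. partial_deriv i (g n) (y n))))"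

definition star_C_infinity :: "(star_real ^ 'k) set \<Rightarrow> (star_real ^ 'l) set \<Rightarrow>
    (star_real ^ 'k \<Rightarrow> star_real ^ 'l) set" where
  "star_C_infinity U V = {f. f ` U \<subseteq> V \<and> (\<forall>i. (\<lambda>x. f x $ i) \<in> star_smooth UNIV U)}"

definition star_jacobian :: "(star_real ^ 'k) set \<Rightarrow> (star_real ^ 'k \<Rightarrow> star_real ^ 'l) \<Rightarrow>
    star_real ^ 'k \<Rightarrow> star_real ^ 'k ^ 'l" where
  "star_jacobian U f x = (\<chi> i j. star_partial UNIV U j (\<lambda>x. f x $ i) x)"

section \<open>Smooth functions on asymptotic domains\<close>

definition rho_lift :: "(rho_real ^ 'k) set \<Rightarrow> (star_real ^ 'k) set" where
  "rho_lift U = {y. (\<forall>i. y $ i \<in> rho_M) \<and> rho_vec y \<in> U}"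

text \<open>The iterated derivatives are indexed by the list of directions; as partial derivatives
  commute, the lists exhaust precisely the derivatives indexed by multi-indices.\<close>

definition rho_L_smooth :: "star_real set \<Rightarrow> (star_real ^ 'k) set \<Rightarrow> (star_real ^ 'k \<Rightarrow> star_real) set"
  where "rho_L_smooth L U' = {\<phi> \<in> star_smooth rho_nets U'.
     \<forall>\<alpha> :: 'k list. \<forall>y\<in>U'. foldr (star_partial rho_nets U') \<alpha> \<phi> y \<in> L}"

definition rho_rel :: "(rho_real ^ 'k) set \<Rightarrow>
    ((star_real ^ 'k \<Rightarrow> star_real) \<times> (star_real ^ 'k \<Rightarrow> star_real)) set" where
  "rho_rel U = {(\<phi>, \<psi>). \<phi> \<in> rho_L_smooth rho_M (rho_lift U) \<and> \<psi> \<in> rho_L_smooth rho_M (rho_lift U) \<and>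
     (\<lambda>y. \<phi> y - \<psi> y) \<in> rho_L_smooth rho_N (rho_lift U)}"

definition rho_classes :: "(rho_real ^ 'k) set \<Rightarrow> (star_real ^ 'k \<Rightarrow> star_real) set set" where
  "rho_classes U = rho_L_smooth rho_M (rho_lift U) // rho_rel U"

text \<open>The function on \<open>U\<close> that a class is regarded as:\<close>

definition rho_eval :: "(rho_real ^ 'k) set \<Rightarrow> (star_real ^ 'k \<Rightarrow> star_real) set \<Rightarrow> rho_real ^ 'k \<Rightarrow> rho_real"
  where "rho_eval U \<Phi> x =
    (THE v. \<exists>\<phi>\<in>\<Phi>. \<exists>y\<in>rho_lift U. rho_vec y = x \<and> v = rho_cls (\<phi> y))"

definition rho_class_partial :: "(rho_real ^ 'k) set \<Rightarrow> 'k \<Rightarrow>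
    (star_real ^ 'k \<Rightarrow> star_real) set \<Rightarrow> (star_real ^ 'k \<Rightarrow> star_real) set" where
  "rho_class_partial U i \<Phi> = rho_rel U `` (star_partial rho_nets (rho_lift U) i ` \<Phi>)"

definition rho_smooth :: "(rho_real ^ 'k) set \<Rightarrow> (rho_real ^ 'k \<Rightarrow> rho_real) set" where
  "rho_smooth U = {f. \<exists>\<Phi>\<in>rho_classes U. \<forall>x\<in>U. f x = rho_eval U \<Phi> x}"

text \<open>A class is determined by its function on \<open>U\<close>, which makes the following well defined.\<close>

definition rho_partial :: "(rho_real ^ 'k) set \<Rightarrow> 'k \<Rightarrow> (rho_real ^ 'k \<Rightarrow> rho_real) \<Rightarrow>
    rho_real ^ 'k \<Rightarrow> rho_real" where
  "rho_partial U i f = rho_eval U (rho_class_partial U i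
     (THE \<Phi>. \<Phi> \<in> rho_classes U \<and> (\<forall>x\<in>U. f x = rho_eval U \<Phi> x)))"

definition rho_C_infinity :: "(rho_real ^ 'k) set \<Rightarrow> (rho_real ^ 'l) set \<Rightarrow>
    (rho_real ^ 'k \<Rightarrow> rho_real ^ 'l) set" where
  "rho_C_infinity U V = {f. f ` U \<subseteq> V \<and> (\<forall>i. (\<lambda>x. f x $ i) \<in> rho_smooth U)}"

definition rho_jacobian :: "(rho_real ^ 'k) set \<Rightarrow> (rho_real ^ 'k \<Rightarrow> rho_real ^ 'l) \<Rightarrow>
    rho_real ^ 'k \<Rightarrow> rho_real ^ 'k ^ 'l" where
  "rho_jacobian U f x = (\<chi> i j. rho_partial U j (\<lambda>x. f x $ i) x)"

end

theory Submission
  imports Defs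
begin

text \<open>
  In the case \<open>*\<close>, fix a point \<open>[y\<^sub>n]\<close> of \<open>U\<close>. Near it every component of \<open>f\<close> is the class of a net
  of smooth functions, which together form a net of smooth maps \<open>F\<^sub>n\<close>; near \<open>f [y\<^sub>n] = [F\<^sub>n(y\<^sub>n)]\<close> a
  component of \<open>g\<close> is the class of a net of smooth functions \<open>G\<^sub>n\<close> with open domains \<open>C\<^sub>n\<close>. Hence the
  component of \<open>g \<circ> f\<close> is the class of the net \<open>G\<^sub>n \<circ> F\<^sub>n\<close>, defined on the intersection of the domains of
  the components of \<open>F\<^sub>n\<close> with \<open>F\<^sub>n\<^sup>-\<^sup>1(C\<^sub>n)\<close>, and the classical chain rule for every single \<open>n\<close> passes
  to classes.

  Two points need care. The domains just described contain \<open>y\<^sub>n\<close> only for almost every \<open>n\<close>, whereas a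
  representation constrains every index; \<open>represents_ae\<close> is the notion that ignores a negligible set of
  indices, and \<open>star_smooth_iff\<close> says that it defines the same smooth functions. Moreover partial
  derivatives are computed from representing nets; that the outcome does not depend on the net
  (\<open>star_partial_eq\<close>) holds because two nets representing the same function agree, for almost every
  \<open>n\<close>, on the whole of their common domain (\<open>represents_ae_unique\<close>): otherwise points at which they
  differ would form a net at which the function had two values.

  The case \<open>\<rho>\<close> reduces to the case \<open>*\<close>. The exponents \<open>c\<close> and \<open>d\<close> that measure growth range over
  all hypernaturals, so every net is bounded by some power \<open>n\<^bsup>c n\<^esup>\<close>, and only the zero class is smaller
  than all \<open>n\<^bsup>- d n\<^esup>\<close>. Therefore the projection from the nonstandard reals to the asymptotic reals is a
  ring isomorphism, the growth conditions on derivatives hold automatically, and two representatives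
  define the same class exactly if they agree on the domain. Conjugating with the projection turns
  asymptotic smooth maps and Jacobians into nonstandard ones (\<open>rho_C_infinity_iff\<close>,
  \<open>rho_jacobian_eq\<close>).
\<close>

section \<open>Smooth functions on open subsets of Euclidean space\<close>

lemma partial_deriv_eq:
  "(g has_derivative g') (at x) \<Longrightarrow> partial_deriv i g x = g' (axis i 1)"
  unfolding partial_deriv_def by (metis frechet_derivative_at)

text \<open>Openness of \<open>V\<close> matters: the partial derivatives at a point of \<open>V\<close> are those of functions on the
  whole space, and they are determined by the values on \<open>V\<close> only because \<open>V\<close> is a neighbourhood. The
  lemma lets the formulas for partial derivatives of sums, products and composites, valid on \<open>V\<close>
  only, be used under \<^const>\<open>C_on\<close>.\<close>

lemma C_on_cong:
  assumes "open V" "\<And>x. x \<in> V \<Longrightarrow> g x = h x" "C_on r V g"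
  shows "C_on r V h"
  using assms
proof (induction r arbitrary: g h)
  case 0
  then show ?case by (simp cong: continuous_on_cong)
next
  case (Suc r)
  have "h differentiable at x" "partial_deriv i g x = partial_deriv i h x" if x: "x \<in> V" for x i
  proof -
    obtain g' where "(g has_derivative g') (at x)"
      using Suc.prems x by (auto simp: differentiable_def)
    moreover from this have "(h has_derivative g') (at x)"
      using Suc.prems x by (auto intro: has_derivative_transform_within_open)
    ultimately show "h differentiable at x" "partial_deriv i g x = partial_deriv i h x"
      by (auto simp: partial_deriv_eq differentiable_def)
  qed
  note h = this
  have "C_on r V (partial_deriv i h)" for i
    by (rule Suc.IH[OF Suc.prems(1), where g = "partial_deriv i g"]) (use h(2) Suc.prems(3) in simp_all)
  with h(1) show ?case by simp
qed

lemma C_on_subset: "C_on r V g \<Longrightarrow> B \<subseteq> V \<Longrightarrow> C_on r B g"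
proof (induction r arbitrary: g)
  case 0
  then show ?case using continuous_on_subset by simp
next
  case (Suc r)
  then show ?case by (simp add: subset_iff)
qed

lemma C_on_Suc_imp: "C_on (Suc r) V g \<Longrightarrow> C_on r V g"
proof (induction r arbitrary: g)
  case 0
  then show ?case
    by (auto intro!: continuous_at_imp_continuous_on differentiable_imp_continuous_within)
next
  case (Suc r)
  from Suc.prems have "C_on r V (partial_deriv i g)" for i
    by (intro Suc.IH) simp
  with Suc.prems show ?case by simp
qed

lemma C_on_0_fun: "C_on r V (\<lambda>_. 0)"
proof (induction r)
  case (Suc r)
  have "partial_deriv i (\<lambda>_. 0) = (\<lambda>_. 0)" for i :: 'a
    by (auto simp: fun_eq_iff intro: partial_deriv_eq)
  with Suc show ?case by simp
qed simp

lemma C_on_add: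
  assumes "open V" "C_on r V g" "C_on r V h"
  shows "C_on r V (\<lambda>x. g x + h x)"
  using assms
proof (induction r arbitrary: g h)
  case (Suc r)
  have eq: "partial_deriv i g x + partial_deriv i h x = partial_deriv i (\<lambda>x. g x + h x) x"
    if x: "x \<in> V" for x i
  proof -
    obtain g' h' where "(g has_derivative g') (at x)" "(h has_derivative h') (at x)"
      using Suc.prems x unfolding differentiable_def C_on.simps by meson
    then show ?thesis
      by (simp add: partial_deriv_eq[OF has_derivative_add] partial_deriv_eq)
  qed
  have "C_on r V (\<lambda>x. partial_deriv i g x + partial_deriv i h x)" for i
    using Suc.prems by (intro Suc.IH) auto
  then have "C_on r V (partial_deriv i (\<lambda>x. g x + h x))" for i
    by (rule C_on_cong[OF Suc.prems(1), rotated]) (simp add: eq)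
  then show ?case
    using Suc.prems by auto
qed (simp add: continuous_on_add)

lemma C_on_sum:
  assumes "open V" "\<And>i. i \<in> I \<Longrightarrow> C_on r V (g i)"
  shows "C_on r V (\<lambda>x. \<Sum>i\<in>I. g i x)"
  using assms(2)
  by (induction I rule: infinite_finite_induct) (simp_all add: C_on_0_fun C_on_add[OF assms(1)])

text \<open>By the Leibniz rule the partial derivatives of a product are again sums of products, now of
  functions of one order less.\<close>

lemma C_on_mult:
  assumes "open V" "C_on r V g" "C_on r V h"
  shows "C_on r V (\<lambda>x. g x * h x)"
  using assms
proof (induction r arbitrary: g h)
  case (Suc r)
  have eq: "g x * partial_deriv i h x + partial_deriv i g x * h x = partial_deriv i (\<lambda>x. g x * h x) x"
    if x: "x \<in> V" for x i
  proof -
    obtain g' h' where "(g has_derivative g') (at x)" "(h has_derivative h') (at x)"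
      using Suc.prems x unfolding differentiable_def C_on.simps by meson
    then show ?thesis
      by (simp add: partial_deriv_eq[OF has_derivative_mult] partial_deriv_eq)
  qed
  have "C_on r V g" "C_on r V h" using Suc.prems C_on_Suc_imp by blast+
  then have "C_on r V (\<lambda>x. g x * partial_deriv i h x + partial_deriv i g x * h x)" for i
    using Suc.prems by (intro C_on_add Suc.IH) auto
  then have "C_on r V (partial_deriv i (\<lambda>x. g x * h x))" for i
    by (rule C_on_cong[OF Suc.prems(1), rotated]) (simp add: eq)
  then show ?case
    using Suc.prems by auto
qed (simp add: continuous_on_mult)

text \<open>The derivative of \<open>F\<close> is assembled from those of its components, and the derivative of \<open>G\<close>,
  being linear, is determined by its values at the unit vectors.\<close>

lemma has_derivative_compose_partial:
  fixes F :: "real ^ 'k \<Rightarrow> real ^ 'l" and G :: "real ^ 'l \<Rightarrow> real"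
  assumes F: "\<And>i. (\<lambda>u. F u $ i) differentiable (at x)" and G: "G differentiable (at (F x))"
  shows "(\<lambda>u. G (F u)) differentiable (at x)"
    and "partial_deriv j (\<lambda>u. G (F u)) x =
      (\<Sum>i\<in>UNIV. partial_deriv i G (F x) * partial_deriv j (\<lambda>u. F u $ i) x)"
proof -
  define F' where "F' = (\<lambda>h. \<chi> i. frechet_derivative (\<lambda>u. F u $ i) (at x) h)"
  define G' where "G' = frechet_derivative G (at (F x))"
  have "(F has_derivative F') (at x)"
    unfolding has_derivative_componentwise_within[of F]
  proof
    fix b :: "real ^ 'l" assume "b \<in> Basis"
    then obtain i where b: "b = axis i 1" by (auto simp: Basis_vec_def)
    show "((\<lambda>u. F u \<bullet> b) has_derivative (\<lambda>h. F' h \<bullet> b)) (at x)"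
      using F[of i, unfolded frechet_derivative_works] by (simp add: b inner_axis F'_def)
  qed
  moreover have G': "(G has_derivative G') (at (F x))"
    using G unfolding G'_def by (simp add: frechet_derivative_works)
  ultimately have comp: "((\<lambda>u. G (F u)) has_derivative (\<lambda>h. G' (F' h))) (at x)"
    by (rule has_derivative_compose)
  then show "(\<lambda>u. G (F u)) differentiable (at x)" by (auto simp: differentiable_def)
  have lin: "linear G'" using G' by (rule has_derivative_linear)
  have expand: "G' v = (\<Sum>i\<in>UNIV. G' (axis i 1) * v $ i)" for v
  proof -
    have "G' v = G' (\<Sum>i\<in>UNIV. v $ i *\<^sub>R axis i 1)"
      using basis_expansion[of v] by (simp add: scalar_mult_eq_scaleR)
    also have "\<dots> = (\<Sum>i\<in>UNIV. v $ i *\<^sub>R G' (axis i 1))"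
      by (simp only: linear_sum[OF lin] linear_scale[OF lin])
    finally show ?thesis by (simp add: mult.commute)
  qed
  have "partial_deriv j (\<lambda>u. G (F u)) x = G' (F' (axis j 1))"
    by (rule partial_deriv_eq[OF comp])
  also have "\<dots> = (\<Sum>i\<in>UNIV. G' (axis i 1) * F' (axis j 1) $ i)" by (rule expand)
  finally show "partial_deriv j (\<lambda>u. G (F u)) x =
      (\<Sum>i\<in>UNIV. partial_deriv i G (F x) * partial_deriv j (\<lambda>u. F u $ i) x)"
    by (simp add: partial_deriv_def F'_def G'_def)
qed

text \<open>By the chain rule the partial derivatives of the composite are sums of products of composites
  \<open>\<partial>\<^sub>iG \<circ> F\<close> with partial derivatives of \<open>F\<close>. The induction therefore varies \<open>G\<close> and keeps \<open>F\<close>.\<close>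

lemma C_on_compose:
  fixes F :: "real ^ 'k \<Rightarrow> real ^ 'l"
  assumes "open B" "\<And>i. C_on r B (\<lambda>u. F u $ i)" "F ` B \<subseteq> A" "C_on r A G"
  shows "C_on r B (\<lambda>u. G (F u))"
  using assms
proof (induction r arbitrary: G)
  case 0
  then have "continuous_on B (\<lambda>u. \<chi> i. F u $ i)"
    by (intro continuous_on_vec_lambda) simp
  then have "continuous_on B F" by simp
  with 0 show ?case by (auto intro: continuous_on_compose2)
next
  case (Suc r)
  have F: "(\<lambda>u. F u $ i) differentiable at x" if "x \<in> B" for i x
    using Suc.prems(2)[of i] that by simp
  have G: "G differentiable at (F x)" if "x \<in> B" for x
    using Suc.prems(3,4) that by auto
  note comp = has_derivative_compose_partial[OF F G]
  have "C_on r B (\<lambda>u. \<Sum>i\<in>UNIV. partial_deriv i G (F u) * partial_deriv j (\<lambda>u. F u $ i) u)" for j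
  proof (intro C_on_sum C_on_mult Suc.prems(1))
    fix i
    show "C_on r B (\<lambda>u. partial_deriv i G (F u))"
      by (rule Suc.IH[OF Suc.prems(1) C_on_Suc_imp[OF Suc.prems(2)] Suc.prems(3)])
        (use Suc.prems(4) in simp)
    show "C_on r B (partial_deriv j (\<lambda>u. F u $ i))"
      using Suc.prems(2)[of i] by simp
  qed
  then have "C_on r B (partial_deriv j (\<lambda>u. G (F u)))" for j
    by (rule C_on_cong[OF Suc.prems(1), rotated])
      (simp only: comp(2))
  then show ?case by (simp add: comp(1))
qed

lemma C_infinity_on_subset: "C_infinity_on V g \<Longrightarrow> B \<subseteq> V \<Longrightarrow> C_infinity_on B g"
  unfolding C_infinity_on_def using C_on_subset by metis

lemma C_infinity_on_Suc: "C_infinity_on V g \<Longrightarrow> C_on (Suc r) V g"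
  unfolding C_infinity_on_def by (rule spec)

lemma C_infinity_on_differentiable: "C_infinity_on V g \<Longrightarrow> x \<in> V \<Longrightarrow> g differentiable (at x)"
  using C_infinity_on_Suc[of V g 0] by simp

lemma C_infinity_on_partial: "C_infinity_on V g \<Longrightarrow> C_infinity_on V (partial_deriv i g)"
  unfolding C_infinity_on_def[of V "partial_deriv i g"]
  using C_infinity_on_Suc[of V g] by simp

lemma C_infinity_on_0: "C_infinity_on V (\<lambda>_. 0)"
  by (simp add: C_infinity_on_def C_on_0_fun)

lemma C_infinity_on_compose:
  fixes F :: "real ^ 'k \<Rightarrow> real ^ 'l"
  assumes "open B" "\<And>i. C_infinity_on B (\<lambda>u. F u $ i)" "F ` B \<subseteq> A" "C_infinity_on A G"
  shows "C_infinity_on B (\<lambda>u. G (F u))"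
  unfolding C_infinity_on_def
proof
  fix r
  show "C_on r B (\<lambda>u. G (F u))"
    by (rule C_on_compose[OF assms(1) _ assms(3)])
      (use assms(2,4) in \<open>simp_all add: C_infinity_on_def\<close>)
qed

section \<open>Representations that hold almost everywhere\<close>

lemma star_vec_eq_iff: "star_vec x = star_vec y \<longleftrightarrow> (\<forall>\<^sub>F n in ultra. x n = y n)"
proof
  assume "star_vec x = star_vec y"
  then have "\<forall>\<^sub>F n in ultra. x n $ i = y n $ i" for i
    by (simp add: star_vec_def vec_eq_iff star_real.abs_eq_iff)
  then have "\<forall>\<^sub>F n in ultra. \<forall>i. x n $ i = y n $ i" by (rule eventually_all_finite)
  then show "\<forall>\<^sub>F n in ultra. x n = y n" by (simp add: vec_eq_iff)
qed (auto simp: star_vec_def vec_eq_iff star_real.abs_eq_iff elim: eventually_mono)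

lemma star_vec_cases: obtains y where "x = star_vec y"
proof -
  have "\<exists>a. x $ i = star_cls a" for i by (meson star_cls_cases)
  then obtain a where "\<And>i. x $ i = star_cls (a i)" by metis
  then have "x = star_vec (\<lambda>n. \<chi> i. a i n)" by (simp add: star_vec_def vec_eq_iff)
  then show thesis by (rule that)
qed

lemma nets_UNIV: "y \<in> nets UNIV V \<longleftrightarrow> (\<forall>n. y n \<in> V n)"
  by (simp add: nets_def)

text \<open>A version of \<^const>\<open>represents\<close> that is insensitive to changing \<open>V\<close> and \<open>g\<close> at a negligible set of
  indices. Membership of nets in \<open>V\<close> is also required only almost everywhere, so that some of the \<open>V n\<close>
  may be empty and finitely many domains may be intersected.\<close>

definition represents_ae :: "(star_real ^ 'k) set \<Rightarrow> (star_real ^ 'k \<Rightarrow> star_real) \<Rightarrow>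
    (nat \<Rightarrow> (real ^ 'k) set) \<Rightarrow> (nat \<Rightarrow> real ^ 'k \<Rightarrow> real) \<Rightarrow> bool" where
  "represents_ae U f V g \<longleftrightarrow>
     (\<forall>\<^sub>F n in ultra. open (V n) \<and> C_infinity_on (V n) (g n)) \<and>
     (\<forall>y. (\<forall>\<^sub>F n in ultra. y n \<in> V n) \<longrightarrow>
        star_vec y \<in> U \<and> f (star_vec y) = star_cls (\<lambda>n. g n (y n)))"

text \<open>The net \<open>y\<close> serves to repair a net that lies in \<open>V\<close> only almost everywhere.\<close>

lemma represents_imp_represents_ae:
  assumes r: "represents UNIV U f V g" and y: "y \<in> nets UNIV V"
  shows "represents_ae U f V g"
  unfolding represents_ae_def
proof (intro conjI allI impI)
  show "\<forall>\<^sub>F n in ultra. open (V n) \<and> C_infinity_on (V n) (g n)"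
    using r by (auto simp: represents_def)
next
  fix z assume z: "\<forall>\<^sub>F n in ultra. z n \<in> V n"
  define z' where "z' = (\<lambda>n. if z n \<in> V n then z n else y n)"
  have nets: "z' \<in> nets UNIV V" using y by (auto simp: z'_def nets_UNIV)
  have eq: "\<forall>\<^sub>F n in ultra. z n = z' n" using z by eventually_elim (simp add: z'_def)
  then have "star_vec z = star_vec z'" by (simp add: star_vec_eq_iff)
  moreover have "star_cls (\<lambda>n. g n (z n)) = star_cls (\<lambda>n. g n (z' n))"
    unfolding star_real.abs_eq_iff using eq by eventually_elim simp
  ultimately show "star_vec z \<in> U" "f (star_vec z) = star_cls (\<lambda>n. g n (z n))"
    using r nets by (auto simp: represents_def star_box_def)
qed

text \<open>At the exceptional indices the zero function on the whole space is substituted; this keeps the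
  representing functions smooth and the given net inside the domains.\<close>

lemma represents_ae_imp_represents:
  assumes r: "represents_ae U f V g" and y: "\<forall>\<^sub>F n in ultra. y n \<in> V n"
  obtains V' g' where "represents UNIV U f V' g'" "y \<in> nets UNIV V'"
    "\<forall>\<^sub>F n in ultra. V' n = V n \<and> g' n = g n"
proof -
  define good where "good n \<longleftrightarrow> open (V n) \<and> C_infinity_on (V n) (g n) \<and> y n \<in> V n" for n
  define V' where "V' n = (if good n then V n else UNIV)" for n
  define g' where "g' n = (if good n then g n else (\<lambda>_. 0))" for n
  from r have "\<forall>\<^sub>F n in ultra. open (V n) \<and> C_infinity_on (V n) (g n)"
    by (simp add: represents_ae_def)
  with y have good: "\<forall>\<^sub>F n in ultra. good n" by eventually_elim (simp add: good_def)
  have "star_vec z \<in> U \<and> f (star_vec z) = star_cls (\<lambda>n. g' n (z n))" if "z \<in> nets UNIV V'" for z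
  proof -
    have "\<forall>\<^sub>F n in ultra. z n \<in> V n"
      using good
    proof eventually_elim
      case (elim n)
      have "z n \<in> V' n" using that by (simp add: nets_UNIV)
      with elim show ?case by (simp add: V'_def)
    qed
    moreover have "star_cls (\<lambda>n. g n (z n)) = star_cls (\<lambda>n. g' n (z n))"
      unfolding star_real.abs_eq_iff using good by eventually_elim (simp add: g'_def)
    ultimately show ?thesis using r by (simp add: represents_ae_def)
  qed
  then have "represents UNIV U f V' g'"
    by (auto simp: represents_def star_box_def V'_def g'_def good_def C_infinity_on_0)
  moreover have "y \<in> nets UNIV V'" by (simp add: nets_UNIV V'_def good_def)
  moreover have "\<forall>\<^sub>F n in ultra. V' n = V n \<and> g' n = g n"
    using good by eventually_elim (simp add: V'_def g'_def)
  ultimately show thesis by (rule that)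
qed

lemma star_smooth_iff:
  "f \<in> star_smooth UNIV U \<longleftrightarrow>
     (\<forall>y. star_vec y \<in> U \<longrightarrow> (\<exists>V g. represents_ae U f V g \<and> (\<forall>\<^sub>F n in ultra. y n \<in> V n)))"
proof
  assume f: "f \<in> star_smooth UNIV U"
  show "\<forall>y. star_vec y \<in> U \<longrightarrow> (\<exists>V g. represents_ae U f V g \<and> (\<forall>\<^sub>F n in ultra. y n \<in> V n))"
  proof (intro allI impI)
    fix y assume "star_vec y \<in> U"
    with f obtain V g z where r: "represents UNIV U f V g" "z \<in> nets UNIV V"
        and eq: "star_vec y = star_vec z"
      unfolding star_smooth_def star_box_def by blast
    from eq have "\<forall>\<^sub>F n in ultra. y n \<in> V n"
      unfolding star_vec_eq_iff by eventually_elim (use r in \<open>simp add: nets_UNIV\<close>)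
    with represents_imp_represents_ae[OF r]
    show "\<exists>V g. represents_ae U f V g \<and> (\<forall>\<^sub>F n in ultra. y n \<in> V n)" by blast
  qed
next
  assume *: "\<forall>y. star_vec y \<in> U \<longrightarrow> (\<exists>V g. represents_ae U f V g \<and> (\<forall>\<^sub>F n in ultra. y n \<in> V n))"
  show "f \<in> star_smooth UNIV U"
    unfolding star_smooth_def
  proof (intro CollectI ballI)
    fix x assume x: "x \<in> U"
    obtain y where y: "x = star_vec y" by (rule star_vec_cases)
    with x * obtain V g where "represents_ae U f V g" "\<forall>\<^sub>F n in ultra. y n \<in> V n" by blast
    then obtain V' g' where "represents UNIV U f V' g'" "y \<in> nets UNIV V'"
      by (rule represents_ae_imp_represents)
    then show "\<exists>V g. represents UNIV U f V g \<and> x \<in> star_box UNIV V"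
      unfolding y star_box_def by blast
  qed
qed

text \<open>If the two nets of functions did not agree almost everywhere, then, \<^const>\<open>ultra\<close> being an
  ultrafilter, they would differ almost everywhere. A net \<open>z\<close> of points at which they differ would give
  \<open>f\<close> two values at \<open>star_vec z\<close>.\<close>

lemma represents_ae_unique:
  assumes "represents_ae U f V g" "represents_ae U f V' g'"
  shows "\<forall>\<^sub>F n in ultra. \<forall>z \<in> V n \<inter> V' n. g n z = g' n z"
proof (rule ccontr)
  assume "\<not> ?thesis"
  then have "\<forall>\<^sub>F n in ultra. \<exists>z \<in> V n \<inter> V' n. g n z \<noteq> g' n z"
    using ultra_cases[of "\<lambda>n. \<forall>z \<in> V n \<inter> V' n. g n z = g' n z"] by simp
  then obtain z where z: "\<forall>\<^sub>F n in ultra. z n \<in> V n \<inter> V' n \<and> g n (z n) \<noteq> g' n (z n)"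
    unfolding Bex_def eventually_ex ..
  have "\<forall>\<^sub>F n in ultra. z n \<in> V n" "\<forall>\<^sub>F n in ultra. z n \<in> V' n"
    using z by (auto elim: eventually_mono)
  then have "star_cls (\<lambda>n. g n (z n)) = star_cls (\<lambda>n. g' n (z n))"
    using assms unfolding represents_ae_def by metis
  then have "\<forall>\<^sub>F n in ultra. g n (z n) = g' n (z n)" by (simp add: star_real.abs_eq_iff)
  with z have "\<forall>\<^sub>F n in ultra. False" by eventually_elim simp
  then show False using ultra_neq_bot by (simp add: eventually_False)
qed

text \<open>The definite description in \<^const>\<open>star_partial\<close> denotes what it should: by
  \<open>represents_ae_unique\<close> two representing functions agree near the point, hence have the same partial
  derivatives there.\<close>

lemma star_partial_eq:
  assumes r: "represents_ae U f V g" and y: "\<forall>\<^sub>F n in ultra. y n \<in> V n"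
  shows "star_partial UNIV U i f (star_vec y) = star_cls (\<lambda>n. partial_deriv i (g n) (y n))"
  unfolding star_partial_def
proof (rule the_equality)
  obtain V' g' where *: "represents UNIV U f V' g'" "y \<in> nets UNIV V'"
    and eq: "\<forall>\<^sub>F n in ultra. V' n = V n \<and> g' n = g n"
    using represents_ae_imp_represents[OF r y] by blast
  have "star_cls (\<lambda>n. partial_deriv i (g n) (y n)) = star_cls (\<lambda>n. partial_deriv i (g' n) (y n))"
    unfolding star_real.abs_eq_iff using eq by eventually_elim simp
  with * show "\<exists>V g'. represents UNIV U f V g' \<and> (\<exists>z\<in>nets UNIV V. star_vec y = star_vec z \<and>
      star_cls (\<lambda>n. partial_deriv i (g n) (y n)) = star_cls (\<lambda>n. partial_deriv i (g' n) (z n)))"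
    by blast
next
  fix d
  assume "\<exists>V g. represents UNIV U f V g \<and> (\<exists>z\<in>nets UNIV V. star_vec y = star_vec z \<and>
      d = star_cls (\<lambda>n. partial_deriv i (g n) (z n)))"
  then obtain V' g' z where r': "represents UNIV U f V' g'" and z: "z \<in> nets UNIV V'"
    and yz: "star_vec y = star_vec z" and d: "d = star_cls (\<lambda>n. partial_deriv i (g' n) (z n))"
    by blast
  have r'': "represents_ae U f V' g'" using r' z by (rule represents_imp_represents_ae)
  from yz have "\<forall>\<^sub>F n in ultra. y n = z n" by (simp add: star_vec_eq_iff)
  moreover have "\<forall>\<^sub>F n in ultra. open (V n) \<and> C_infinity_on (V n) (g n)"
    using r by (simp add: represents_ae_def)
  ultimately have "\<forall>\<^sub>F n in ultra. partial_deriv i (g' n) (z n) = partial_deriv i (g n) (y n)"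
    using represents_ae_unique[OF r r''] y
  proof eventually_elim
    case (elim n)
    have "open (V' n)" "z n \<in> V' n" using r' z by (auto simp: represents_def nets_UNIV)
    with elim have "frechet_derivative (g n) (at (y n)) = frechet_derivative (g' n) (at (y n))"
      by (intro frechet_derivative_transform_within_open[of _ _ "V n \<inter> V' n"])
        (auto intro: C_infinity_on_differentiable)
    with elim show ?case by (simp add: partial_deriv_def)
  qed
  then show "d = star_cls (\<lambda>n. partial_deriv i (g n) (y n))"
    by (simp add: d star_real.abs_eq_iff)
qed

lemma represents_ae_partial:
  assumes r: "represents_ae U f V g"
  shows "represents_ae U (star_partial UNIV U i f) V (\<lambda>n. partial_deriv i (g n))"
proof -
  have "\<forall>\<^sub>F n in ultra. open (V n) \<and> C_infinity_on (V n) (partial_deriv i (g n))"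
    using r unfolding represents_ae_def by (auto elim!: eventually_mono intro: C_infinity_on_partial)
  then show ?thesis
    using r star_partial_eq[OF r] by (auto simp: represents_ae_def)
qed

lemma star_smooth_partial: "f \<in> star_smooth UNIV U \<Longrightarrow> star_partial UNIV U i f \<in> star_smooth UNIV U"
  unfolding star_smooth_iff by (meson represents_ae_partial)

section \<open>Composition and the chain rule over the nonstandard reals\<close>

lemma star_cls_sum:
  "star_cls (\<lambda>n. \<Sum>i\<in>I. a i n) = (\<Sum>i\<in>I. star_cls (a i))"
  by (induction I rule: infinite_finite_induct)
    (simp_all add: zero_star_real_def flip: plus_star_real.abs_eq)

lemma star_vec_represents:
  fixes f :: "star_real ^ 'k \<Rightarrow> star_real ^ 'l"
  assumes "\<And>i. represents_ae U (\<lambda>x. f x $ i) (V i) (g i)" "\<And>i. \<forall>\<^sub>F n in ultra. y n \<in> V i n"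
  shows "f (star_vec y) = star_vec (\<lambda>n. \<chi> i. g i n (y n))"
  using assms by (simp add: represents_ae_def star_vec_def vec_eq_iff)

text \<open>Almost all \<open>V i n\<close> are open for all \<open>i\<close> at once since there are finitely many \<open>i\<close>.\<close>

lemma represents_ae_compose:
  fixes f :: "star_real ^ 'k \<Rightarrow> star_real ^ 'l" and h :: "star_real ^ 'l \<Rightarrow> star_real"
  assumes rf: "\<And>i. represents_ae U (\<lambda>x. f x $ i) (V i) (g i)"
    and rh: "represents_ae A h C d"
  shows "represents_ae U (\<lambda>x. h (f x))
    (\<lambda>n. (\<Inter>i. V i n) \<inter> (\<lambda>u. \<chi> i. g i n u) -` C n) (\<lambda>n u. d n (\<chi> i. g i n u))"
    (is "represents_ae U _ ?B ?H")
  unfolding represents_ae_def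
proof (intro conjI allI impI)
  have "\<forall>\<^sub>F n in ultra. open (V i n) \<and> C_infinity_on (V i n) (g i n)" for i
    using rf by (simp add: represents_ae_def)
  then have "\<forall>\<^sub>F n in ultra. \<forall>i. open (V i n) \<and> C_infinity_on (V i n) (g i n)"
    by (rule eventually_all_finite)
  moreover have "\<forall>\<^sub>F n in ultra. open (C n) \<and> C_infinity_on (C n) (d n)"
    using rh by (simp add: represents_ae_def)
  ultimately show "\<forall>\<^sub>F n in ultra. open (?B n) \<and> C_infinity_on (?B n) (?H n)"
  proof eventually_elim
    case (elim n)
    have opn: "open (\<Inter>i. V i n)" using elim by (intro open_INT) auto
    have "C_on 0 (V i n) (g i n)" for i using elim unfolding C_infinity_on_def by blast
    then have "continuous_on (\<Inter>i. V i n) (\<lambda>u. \<chi> i. g i n u)"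
      by (intro continuous_on_vec_lambda) (auto intro: continuous_on_subset)
    from continuous_open_preimage[OF this opn] have "open (?B n)"
      using elim by simp
    moreover have "C_infinity_on (?B n) (?H n)"
    proof -
      have F: "C_infinity_on (?B n) (\<lambda>u. (\<chi> i. g i n u) $ i)" for i
      proof -
        have "C_infinity_on (V i n) (g i n)" using elim by blast
        moreover have "?B n \<subseteq> V i n" by blast
        ultimately show ?thesis unfolding vec_lambda_beta by (rule C_infinity_on_subset)
      qed
      have FC: "(\<lambda>u. \<chi> i. g i n u) ` ?B n \<subseteq> C n" by blast
      show ?thesis
        by (rule C_infinity_on_compose[OF \<open>open (?B n)\<close> F FC]) (use elim in blast)
    qed
    ultimately show ?case ..
  qed
next
  fix y assume "\<forall>\<^sub>F n in ultra. y n \<in> ?B n"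
  then have V: "\<forall>\<^sub>F n in ultra. y n \<in> V i n" and C: "\<forall>\<^sub>F n in ultra. (\<chi> i. g i n (y n)) \<in> C n" for i
    by (auto elim: eventually_mono)
  then show "star_vec y \<in> U" using rf by (auto simp: represents_ae_def)
  show "h (f (star_vec y)) = star_cls (\<lambda>n. ?H n (y n))"
    using rh C by (simp add: star_vec_represents[OF rf V] represents_ae_def)
qed

lemma star_compose:
  fixes f :: "star_real ^ 'k \<Rightarrow> star_real ^ 'l" and h :: "star_real ^ 'l \<Rightarrow> star_real"
  assumes f: "\<And>i. (\<lambda>x. f x $ i) \<in> star_smooth UNIV U" and fU: "f ` U \<subseteq> V"
    and h: "h \<in> star_smooth UNIV V"
  shows "(\<lambda>x. h (f x)) \<in> star_smooth UNIV U"
    and "x \<in> U \<Longrightarrow> star_partial UNIV U j (\<lambda>x. h (f x)) x =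
      (\<Sum>i\<in>UNIV. star_partial UNIV V i h (f x) * star_partial UNIV U j (\<lambda>x. f x $ i) x)"
proof -
  have *: "(\<exists>B H. represents_ae U (\<lambda>x. h (f x)) B H \<and> (\<forall>\<^sub>F n in ultra. y n \<in> B n)) \<and>
      star_partial UNIV U j (\<lambda>x. h (f x)) (star_vec y) =
      (\<Sum>i\<in>UNIV. star_partial UNIV V i h (f (star_vec y)) *
        star_partial UNIV U j (\<lambda>x. f x $ i) (star_vec y))" if y: "star_vec y \<in> U" for y j
  proof -
    have "\<exists>A g. represents_ae U (\<lambda>x. f x $ i) A g \<and> (\<forall>\<^sub>F n in ultra. y n \<in> A n)" for i
      using f[of i] y unfolding star_smooth_iff by blast
    then obtain A g where rf: "\<And>i. represents_ae U (\<lambda>x. f x $ i) (A i) (g i)"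
      and yA: "\<And>i. \<forall>\<^sub>F n in ultra. y n \<in> A i n"
      by metis
    define F where "F n u = (\<chi> i. g i n u)" for n u
    have fy: "f (star_vec y) = star_vec (\<lambda>n. F n (y n))"
      using star_vec_represents[OF rf yA] by (simp add: F_def)
    have "f (star_vec y) \<in> V" using y fU by blast
    then obtain C d where rh: "represents_ae V h C d" and yC: "\<forall>\<^sub>F n in ultra. F n (y n) \<in> C n"
      using h unfolding star_smooth_iff fy by blast
    define B where "B n = (\<Inter>i. A i n) \<inter> F n -` C n" for n
    have r: "represents_ae U (\<lambda>x. h (f x)) B (\<lambda>n u. d n (F n u))"
      unfolding B_def F_def by (rule represents_ae_compose[OF rf rh])
    have "\<forall>\<^sub>F n in ultra. \<forall>i. y n \<in> A i n" using yA by (rule eventually_all_finite)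
    with yC have yB: "\<forall>\<^sub>F n in ultra. y n \<in> B n" by eventually_elim (simp add: B_def)
    have "\<forall>\<^sub>F n in ultra. C_infinity_on (A i n) (g i n)" for i
      using rf[of i] unfolding represents_ae_def by (auto elim: eventually_mono)
    then have "\<forall>\<^sub>F n in ultra. \<forall>i. C_infinity_on (A i n) (g i n)" by (rule eventually_all_finite)
    moreover have "\<forall>\<^sub>F n in ultra. C_infinity_on (C n) (d n)"
      using rh unfolding represents_ae_def by (auto elim: eventually_mono)
    ultimately have "\<forall>\<^sub>F n in ultra. partial_deriv j (\<lambda>u. d n (F n u)) (y n) =
        (\<Sum>i\<in>UNIV. partial_deriv i (d n) (F n (y n)) * partial_deriv j (g i n) (y n))"
      using yB
    proof eventually_elim
      case (elim n)
      then have "(\<lambda>u. F n u $ i) differentiable at (y n)" for i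
        unfolding F_def B_def by (auto intro: C_infinity_on_differentiable)
      moreover have "d n differentiable at (F n (y n))"
        using elim by (auto simp: B_def intro: C_infinity_on_differentiable)
      ultimately show ?case
        by (simp add: has_derivative_compose_partial(2)) (simp add: F_def)
    qed
    then have "star_partial UNIV U j (\<lambda>x. h (f x)) (star_vec y) =
        star_cls (\<lambda>n. \<Sum>i\<in>UNIV. partial_deriv i (d n) (F n (y n)) * partial_deriv j (g i n) (y n))"
      by (simp add: star_partial_eq[OF r yB] star_real.abs_eq_iff)
    also have "\<dots> = (\<Sum>i\<in>UNIV. star_partial UNIV V i h (f (star_vec y)) *
        star_partial UNIV U j (\<lambda>x. f x $ i) (star_vec y))"
      unfolding fy
      by (simp add: star_cls_sum star_partial_eq[OF rh yC] star_partial_eq[OF rf yA]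
          times_star_real.abs_eq)
    finally show ?thesis using r yB by blast
  qed
  show "(\<lambda>x. h (f x)) \<in> star_smooth UNIV U"
    unfolding star_smooth_iff using * by blast
  show "star_partial UNIV U j (\<lambda>x. h (f x)) x =
      (\<Sum>i\<in>UNIV. star_partial UNIV V i h (f x) * star_partial UNIV U j (\<lambda>x. f x $ i) x)" if "x \<in> U"
  proof -
    obtain y where y: "x = star_vec y" by (rule star_vec_cases)
    with that have "star_vec y \<in> U" by simp
    from conjunct2[OF *[OF this]] show ?thesis unfolding y .
  qed
qed

lemma star_C_infinityD:
  assumes "f \<in> star_C_infinity U V"
  shows "f ` U \<subseteq> V" and "(\<lambda>x. f x $ i) \<in> star_smooth UNIV U"
  using assms by (simp_all add: star_C_infinity_def)

lemma star_C_infinity_compose: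
  assumes "f \<in> star_C_infinity U V" "g \<in> star_C_infinity V W"
  shows "g \<circ> f \<in> star_C_infinity U W"
proof -
  note f = star_C_infinityD[OF assms(1)] and g = star_C_infinityD[OF assms(2)]
  have "(\<lambda>x. g (f x) $ i) \<in> star_smooth UNIV U" for i
    by (rule star_compose(1)[where h = "\<lambda>y. g y $ i", OF f(2,1) g(2)])
  moreover have "(g \<circ> f) ` U \<subseteq> W" using f(1) g(1) unfolding image_comp[symmetric] by blast
  ultimately show ?thesis by (simp add: star_C_infinity_def)
qed

lemma star_jacobian_compose:
  assumes "f \<in> star_C_infinity U V" "g \<in> star_C_infinity V W" "x \<in> U"
  shows "star_jacobian U (g \<circ> f) x = star_jacobian V g (f x) ** star_jacobian U f x"
proof -
  note f = star_C_infinityD[OF assms(1)] and g = star_C_infinityD[OF assms(2)]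
  have "star_partial UNIV U j (\<lambda>x. g (f x) $ i) x =
      (\<Sum>k\<in>UNIV. star_partial UNIV V k (\<lambda>y. g y $ i) (f x) * star_partial UNIV U j (\<lambda>x. f x $ k) x)"
    for i j
    by (rule star_compose(2)[where h = "\<lambda>y. g y $ i", OF f(2,1) g(2) assms(3)])
  then show ?thesis
    unfolding star_jacobian_def matrix_matrix_mult_def vec_eq_iff by simp
qed

section \<open>Asymptotic numbers are nonstandard reals\<close>

lemma le_two_power_ceiling: "x \<le> 2 ^ nat \<lceil>x\<rceil>" for x :: real
proof -
  have "x \<le> real (nat \<lceil>x\<rceil>)" by linarith
  also have "\<dots> \<le> 2 ^ nat \<lceil>x\<rceil>" by (metis less_exp less_imp_le of_nat_le_iff of_nat_numeral of_nat_power)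
  finally show ?thesis .
qed

text \<open>Since the exponent may depend on \<open>n\<close>, no net grows too fast: \<open>\<bar>a n\<bar> \<le> 2 ^ c \<le> n ^ c\<close> for
  \<open>c = \<lceil>\<bar>a n\<bar>\<rceil>\<close> and \<open>n \<ge> 2\<close>.\<close>

lemma abs_net_le_power:
  fixes a :: "nat \<Rightarrow> real"
  shows "\<forall>\<^sub>F n in ultra. \<bar>a n\<bar> \<le> real n ^ nat \<lceil>\<bar>a n\<bar>\<rceil>"
  using ultra_ge[of 2]
proof eventually_elim
  case (elim n)
  have "\<bar>a n\<bar> \<le> 2 ^ nat \<lceil>\<bar>a n\<bar>\<rceil>" by (rule le_two_power_ceiling)
  also have "\<dots> \<le> real n ^ nat \<lceil>\<bar>a n\<bar>\<rceil>" using elim by (intro power_mono) auto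
  finally show ?case .
qed

lemma rho_nets_eq_UNIV: "rho_nets = UNIV"
  unfolding rho_nets_def using abs_net_le_power
  by (auto intro: exI[of _ "\<lambda>n. nat \<lceil>\<bar>_ n\<bar>\<rceil>"])

lemma rho_M_eq_UNIV: "rho_M = UNIV"
proof -
  have "x \<in> rho_M" for x
  proof -
    obtain a where a: "x = star_cls a" by (meson star_cls_cases)
    define c where "c n = nat \<lceil>\<bar>a n\<bar>\<rceil>" for n
    have "\<forall>\<^sub>F n in ultra. \<bar>a n\<bar> \<le> real n ^ c n"
      unfolding c_def by (rule abs_net_le_power)
    with ultra_ge[of 1] have "\<forall>\<^sub>F n in ultra. \<bar>a n\<bar> \<le> (1 / real n) powr (- real (c n))"
      by eventually_elim (simp add: powr_minus powr_realpow power_one_over)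
    then have "\<bar>x\<bar> \<le> star_powr rho (- star_cls (\<lambda>n. real (c n)))"
      by (simp add: a rho_def abs_star_real.abs_eq uminus_star_real.abs_eq star_powr.abs_eq
          less_eq_star_real.abs_eq)
    then show ?thesis unfolding rho_M_def star_nat_def by blast
  qed
  then show ?thesis by blast
qed

text \<open>A net \<open>a\<close> that does not vanish is not negligible: the exponent \<open>d n\<close> below is chosen, depending
  on \<open>a n\<close>, so large that \<open>n ^ d n\<close> exceeds \<open>1 / \<bar>a n\<bar>\<close>. Adding \<open>1\<close> makes the excess strict.\<close>

lemma rho_N_eq_0: "rho_N = {0}"
proof -
  have "x = 0" if x: "x \<in> rho_N" for x
  proof -
    obtain a where a: "x = star_cls a" by (meson star_cls_cases)
    define d where "d n = nat \<lceil>1 / \<bar>a n\<bar>\<rceil> + 1" for n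
    have "\<bar>x\<bar> \<le> star_powr rho (star_cls (\<lambda>n. real (d n)))"
      using x unfolding rho_N_def star_nat_def by blast
    then have "\<forall>\<^sub>F n in ultra. \<bar>a n\<bar> \<le> (1 / real n) powr real (d n)"
      by (simp add: a rho_def abs_star_real.abs_eq star_powr.abs_eq less_eq_star_real.abs_eq)
    then have "\<forall>\<^sub>F n in ultra. a n = 0"
      using ultra_ge[of 2]
    proof eventually_elim
      case (elim n)
      show ?case
      proof (rule ccontr)
        assume nz: "a n \<noteq> 0"
        have "1 / \<bar>a n\<bar> \<le> 2 ^ nat \<lceil>1 / \<bar>a n\<bar>\<rceil>" by (rule le_two_power_ceiling)
        also have "\<dots> < 2 ^ d n" by (simp add: d_def)
        also have "\<dots> \<le> real n ^ d n" using elim by (intro power_mono) auto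
        finally have "1 < \<bar>a n\<bar> * real n ^ d n" using nz by (simp add: field_simps)
        moreover have "\<bar>a n\<bar> * real n ^ d n \<le> 1"
          using elim by (simp add: powr_realpow power_divide field_simps)
        ultimately show False by simp
      qed
    qed
    then show ?thesis by (simp add: a zero_star_real_def star_real.abs_eq_iff)
  qed
  then show ?thesis using rho_N_0 by blast
qed

lemma rho_cls_eq_iff: "rho_cls a = rho_cls b \<longleftrightarrow> a = b"
  using Quotient3_rel[OF Quotient3_rho_real, of a b] by (simp add: rho_M_eq_UNIV rho_N_eq_0)

lemma rho_cls_rep_rho: "rho_cls (rep_rho x) = x"
  by (rule Quotient3_abs_rep[OF Quotient3_rho_real])

lemma rep_rho_rho_cls: "rep_rho (rho_cls a) = a"
  using rho_cls_rep_rho rho_cls_eq_iff by blast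

text \<open>The entries of a product of matrices have this form.\<close>

lemma rho_cls_sum_mult: "rho_cls (\<Sum>i\<in>I. a i * b i) = (\<Sum>i\<in>I. rho_cls (a i) * rho_cls (b i))"
proof -
  have add: "rho_cls (a + b) = rho_cls a + rho_cls b"
    and mult: "rho_cls (a * b) = rho_cls a * rho_cls b" for a b
    by (simp_all add: plus_rho_real.abs_eq times_rho_real.abs_eq eq_onp_def rho_M_eq_UNIV rho_N_0)
  show ?thesis
    by (induction I rule: infinite_finite_induct) (simp_all add: add mult zero_rho_real_def)
qed

definition star_of_rho_vec :: "rho_real ^ 'k \<Rightarrow> star_real ^ 'k" where
  "star_of_rho_vec x = (\<chi> i. rep_rho (x $ i))"

lemma rho_vec_star_of_rho_vec: "rho_vec (star_of_rho_vec x) = x"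
  and star_of_rho_vec_rho_vec: "star_of_rho_vec (rho_vec y) = y"
  by (simp_all add: rho_vec_def star_of_rho_vec_def vec_eq_iff rho_cls_rep_rho rep_rho_rho_cls)

lemma rho_vec_eq_iff: "rho_vec y = rho_vec z \<longleftrightarrow> y = z"
  by (metis star_of_rho_vec_rho_vec)

lemma all_rho_vec: "(\<forall>x. P x) \<longleftrightarrow> (\<forall>y. P (rho_vec y))"
  by (metis rho_vec_star_of_rho_vec)

lemma rho_lift_iff: "y \<in> rho_lift U \<longleftrightarrow> rho_vec y \<in> U"
  by (simp add: rho_lift_def rho_M_eq_UNIV)

section \<open>Asymptotic smooth functions are nonstandard smooth functions\<close>

lemma represents_cong:
  assumes "\<And>x. x \<in> U \<Longrightarrow> f x = h x"
  shows "represents M U f V g \<longleftrightarrow> represents M U h V g"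
  using assms unfolding represents_def star_box_def by (auto simp: image_subset_iff)

lemma star_smooth_cong:
  assumes "\<And>x. x \<in> U \<Longrightarrow> f x = h x"
  shows "f \<in> star_smooth M U \<longleftrightarrow> h \<in> star_smooth M U"
proof -
  have "represents M U f = represents M U h" by (intro ext represents_cong assms)
  then show ?thesis by (simp add: star_smooth_def)
qed

lemma star_partial_cong:
  assumes "\<And>x. x \<in> U \<Longrightarrow> f x = h x"
  shows "star_partial M U i f = star_partial M U i h"
proof -
  have "represents M U f = represents M U h" by (intro ext represents_cong assms)
  then show ?thesis by (simp add: star_partial_def fun_eq_iff)
qed

text \<open>The existence of some smooth function on \<open>U\<close> supplies the boxes around the points of \<open>U\<close> on which
  zero is represented by zero functions.\<close>

lemma star_zero_smooth:
  assumes "f \<in> star_smooth UNIV U"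
  shows "(\<lambda>_. 0) \<in> star_smooth UNIV U"
    and "x \<in> U \<Longrightarrow> star_partial UNIV U i (\<lambda>_. 0) x = 0"
proof -
  have *: "\<exists>V. represents_ae U (\<lambda>_. 0) V (\<lambda>_ _. 0) \<and> (\<forall>\<^sub>F n in ultra. y n \<in> V n)"
    if yU: "star_vec y \<in> U" for y
  proof -
    obtain V g where r: "represents_ae U f V g" and y: "\<forall>\<^sub>F n in ultra. y n \<in> V n"
      using assms yU unfolding star_smooth_iff by blast
    have "\<forall>\<^sub>F n in ultra. open (V n)"
      using r unfolding represents_ae_def by (auto elim: eventually_mono)
    with r have "represents_ae U (\<lambda>_. 0) V (\<lambda>_ _. 0)"
      by (simp add: represents_ae_def C_infinity_on_0 zero_star_real_def)
    with y show ?thesis by blast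
  qed
  then show "(\<lambda>_. 0) \<in> star_smooth UNIV U" unfolding star_smooth_iff by blast
  have 0: "partial_deriv i (\<lambda>_. 0) z = 0" for z :: "real ^ 'a"
    by (rule partial_deriv_eq[OF has_derivative_const])
  show "star_partial UNIV U i (\<lambda>_. 0) x = 0" if "x \<in> U"
  proof -
    obtain y where y: "x = star_vec y" by (rule star_vec_cases)
    with * that obtain V where "represents_ae U (\<lambda>_. 0) V (\<lambda>_ _. 0)" "\<forall>\<^sub>F n in ultra. y n \<in> V n"
      by blast
    from star_partial_eq[OF this, of i] show ?thesis by (simp add: y 0 zero_star_real_def)
  qed
qed

lemma rho_L_smooth_M: "rho_L_smooth rho_M U = star_smooth UNIV U"
  by (simp add: rho_L_smooth_def rho_M_eq_UNIV rho_nets_eq_UNIV)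

text \<open>A function with values in \<^const>\<open>rho_N\<close> vanishes, and then so do all its derivatives, because the
  partial derivatives of a function on \<open>U\<close> depend only on its values on \<open>U\<close>.\<close>

lemma rho_L_smooth_N:
  "rho_L_smooth rho_N U = {\<phi> \<in> star_smooth UNIV U. \<forall>y\<in>U. \<phi> y = 0}"
proof (intro equalityI subsetI)
  fix \<phi> assume "\<phi> \<in> rho_L_smooth rho_N U"
  then have "\<phi> \<in> star_smooth UNIV U"
    and "\<forall>\<alpha>. \<forall>y\<in>U. foldr (star_partial rho_nets U) \<alpha> \<phi> y \<in> rho_N"
    by (auto simp: rho_L_smooth_def rho_nets_eq_UNIV)
  from this(1) spec[OF this(2), of "[]"] show "\<phi> \<in> {\<phi> \<in> star_smooth UNIV U. \<forall>y\<in>U. \<phi> y = 0}"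
    by (simp add: rho_N_eq_0)
next
  fix \<phi> assume \<phi>: "\<phi> \<in> {\<phi> \<in> star_smooth UNIV U. \<forall>y\<in>U. \<phi> y = 0}"
  have "\<forall>y\<in>U. foldr (star_partial UNIV U) \<alpha> \<phi> y = 0" for \<alpha>
  proof (induction \<alpha>)
    case (Cons i \<alpha>)
    then have "star_partial UNIV U i (foldr (star_partial UNIV U) \<alpha> \<phi>) =
        star_partial UNIV U i (\<lambda>_. 0)"
      by (intro star_partial_cong) simp
    with \<phi> show ?case by (auto simp: star_zero_smooth(2))
  qed (use \<phi> in simp)
  with \<phi> show "\<phi> \<in> rho_L_smooth rho_N U"
    by (simp add: rho_L_smooth_def rho_nets_eq_UNIV rho_N_eq_0)
qed

lemma rho_rel_iff:
  "(\<phi>, \<psi>) \<in> rho_rel U \<longleftrightarrow> \<phi> \<in> star_smooth UNIV (rho_lift U) \<and> \<psi> \<in> star_smooth UNIV (rho_lift U) \<and>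
     (\<forall>y\<in>rho_lift U. \<phi> y = \<psi> y)"
proof -
  have "(\<lambda>y. \<phi> y - \<psi> y) \<in> star_smooth UNIV (rho_lift U)"
    if "\<phi> \<in> star_smooth UNIV (rho_lift U)" "\<forall>y\<in>rho_lift U. \<phi> y = \<psi> y"
    using star_zero_smooth(1)[OF that(1)] that(2)
    by (subst star_smooth_cong[where h = "\<lambda>_. 0"]) auto
  then show ?thesis by (auto simp: rho_rel_def rho_L_smooth_M rho_L_smooth_N)
qed

lemma rho_eval_class:
  assumes "\<phi> \<in> star_smooth UNIV (rho_lift U)" "y \<in> rho_lift U"
  shows "rho_eval U (rho_rel U `` {\<phi>}) (rho_vec y) = rho_cls (\<phi> y)"
  unfolding rho_eval_def
proof (rule the_equality)
  have "\<phi> \<in> rho_rel U `` {\<phi>}" using assms by (simp add: rho_rel_iff)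
  with assms show "\<exists>\<psi>\<in>rho_rel U `` {\<phi>}. \<exists>z\<in>rho_lift U. rho_vec z = rho_vec y \<and> rho_cls (\<phi> y) = rho_cls (\<psi> z)"
    by blast
qed (auto simp: rho_vec_eq_iff rho_rel_iff)

lemma rho_class_partial_class:
  assumes "\<phi> \<in> star_smooth UNIV (rho_lift U)"
  shows "rho_class_partial U i (rho_rel U `` {\<phi>}) =
    rho_rel U `` {star_partial UNIV (rho_lift U) i \<phi>}"
proof -
  have "star_partial UNIV (rho_lift U) i \<psi> = star_partial UNIV (rho_lift U) i \<phi>"
    if "\<psi> \<in> rho_rel U `` {\<phi>}" for \<psi>
    using that by (intro star_partial_cong) (simp add: rho_rel_iff)
  moreover have "\<phi> \<in> rho_rel U `` {\<phi>}" using assms by (simp add: rho_rel_iff)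
  ultimately have "star_partial UNIV (rho_lift U) i ` (rho_rel U `` {\<phi>}) =
      {star_partial UNIV (rho_lift U) i \<phi>}"
    by blast
  then show ?thesis by (simp add: rho_class_partial_def rho_nets_eq_UNIV)
qed

lemma rho_classes_iff:
  "\<Phi> \<in> rho_classes U \<longleftrightarrow> (\<exists>\<phi>\<in>star_smooth UNIV (rho_lift U). \<Phi> = rho_rel U `` {\<phi>})"
  unfolding rho_classes_def quotient_def rho_L_smooth_M by blast

text \<open>The function that a class is regarded as determines the values of its representatives on the
  lifted domain. This yields at once that \<^const>\<open>rho_smooth\<close> is nonstandard smoothness and that the
  class in \<^const>\<open>rho_partial\<close> is unique.\<close>

lemma eq_rho_eval_class_iff:
  assumes "\<phi> \<in> star_smooth UNIV (rho_lift U)"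
  shows "(\<forall>x\<in>U. f x = rho_eval U (rho_rel U `` {\<phi>}) x) \<longleftrightarrow>
    (\<forall>y\<in>rho_lift U. rep_rho (f (rho_vec y)) = \<phi> y)"
proof -
  have "(\<forall>x\<in>U. f x = rho_eval U (rho_rel U `` {\<phi>}) x) \<longleftrightarrow>
      (\<forall>y\<in>rho_lift U. f (rho_vec y) = rho_eval U (rho_rel U `` {\<phi>}) (rho_vec y))"
    unfolding Ball_def rho_lift_iff by (rule all_rho_vec)
  also have "\<dots> \<longleftrightarrow> (\<forall>y\<in>rho_lift U. f (rho_vec y) = rho_cls (\<phi> y))"
    using rho_eval_class[OF assms] by simp
  also have "\<dots> \<longleftrightarrow> (\<forall>y\<in>rho_lift U. rep_rho (f (rho_vec y)) = \<phi> y)"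
    by (metis rho_cls_rep_rho rep_rho_rho_cls)
  finally show ?thesis .
qed

lemma rho_smooth_iff:
  "f \<in> rho_smooth U \<longleftrightarrow> (\<lambda>y. rep_rho (f (rho_vec y))) \<in> star_smooth UNIV (rho_lift U)"
    (is "_ \<longleftrightarrow> ?\<phi> \<in> _")
proof
  assume "f \<in> rho_smooth U"
  then obtain \<Phi> where "\<Phi> \<in> rho_classes U" "\<forall>x\<in>U. f x = rho_eval U \<Phi> x"
    unfolding rho_smooth_def by blast
  then obtain \<phi> where \<phi>: "\<phi> \<in> star_smooth UNIV (rho_lift U)"
    and f: "\<forall>x\<in>U. f x = rho_eval U (rho_rel U `` {\<phi>}) x"
    unfolding rho_classes_iff by blast
  from f have "?\<phi> y = \<phi> y" if "y \<in> rho_lift U" for y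
    using that unfolding eq_rho_eval_class_iff[OF \<phi>] by blast
  then have "?\<phi> \<in> star_smooth UNIV (rho_lift U) \<longleftrightarrow> \<phi> \<in> star_smooth UNIV (rho_lift U)"
    by (rule star_smooth_cong)
  with \<phi> show "?\<phi> \<in> star_smooth UNIV (rho_lift U)" by simp
next
  assume \<phi>: "?\<phi> \<in> star_smooth UNIV (rho_lift U)"
  have "\<forall>x\<in>U. f x = rho_eval U (rho_rel U `` {?\<phi>}) x"
    unfolding eq_rho_eval_class_iff[OF \<phi>] by blast
  moreover have "rho_rel U `` {?\<phi>} \<in> rho_classes U"
    unfolding rho_classes_iff using \<phi> by blast
  ultimately show "f \<in> rho_smooth U" unfolding rho_smooth_def by blast
qed

lemma rho_partial_eq:
  assumes "f \<in> rho_smooth U" "y \<in> rho_lift U"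
  shows "rho_partial U i f (rho_vec y) =
    rho_cls (star_partial UNIV (rho_lift U) i (\<lambda>y. rep_rho (f (rho_vec y))) y)"
proof -
  let ?\<phi> = "\<lambda>y. rep_rho (f (rho_vec y))"
  have \<phi>: "?\<phi> \<in> star_smooth UNIV (rho_lift U)" using assms(1) unfolding rho_smooth_iff .
  have "(THE \<Phi>. \<Phi> \<in> rho_classes U \<and> (\<forall>x\<in>U. f x = rho_eval U \<Phi> x)) = rho_rel U `` {?\<phi>}"
  proof (rule the_equality)
    have "rho_rel U `` {?\<phi>} \<in> rho_classes U"
      unfolding rho_classes_iff using \<phi> by blast
    then show "rho_rel U `` {?\<phi>} \<in> rho_classes U \<and>
        (\<forall>x\<in>U. f x = rho_eval U (rho_rel U `` {?\<phi>}) x)"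
      unfolding eq_rho_eval_class_iff[OF \<phi>] by blast
  next
    fix \<Phi> assume \<Phi>: "\<Phi> \<in> rho_classes U \<and> (\<forall>x\<in>U. f x = rho_eval U \<Phi> x)"
    then obtain \<psi> where \<psi>: "\<psi> \<in> star_smooth UNIV (rho_lift U)" and eq: "\<Phi> = rho_rel U `` {\<psi>}"
      unfolding rho_classes_iff by blast
    have agree: "?\<phi> z = \<psi> z" if "z \<in> rho_lift U" for z
      using \<Phi> that unfolding eq eq_rho_eval_class_iff[OF \<psi>] by blast
    have "(\<psi>, \<theta>) \<in> rho_rel U \<longleftrightarrow> (?\<phi>, \<theta>) \<in> rho_rel U" for \<theta>
      unfolding rho_rel_iff using \<phi> \<psi> agree by auto
    then show "\<Phi> = rho_rel U `` {?\<phi>}" unfolding eq by blast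
  qed
  then have "rho_partial U i f = rho_eval U (rho_rel U `` {star_partial UNIV (rho_lift U) i ?\<phi>})"
    unfolding rho_partial_def by (simp only: rho_class_partial_class[OF \<phi>])
  then show ?thesis
    by (simp only: rho_eval_class[OF star_smooth_partial[OF \<phi>] assms(2)])
qed

section \<open>Transfer of composition and chain rule to the asymptotic case\<close>

definition star_of_rho_map :: "(rho_real ^ 'k \<Rightarrow> rho_real ^ 'l) \<Rightarrow> star_real ^ 'k \<Rightarrow> star_real ^ 'l"
  where "star_of_rho_map f = star_of_rho_vec \<circ> f \<circ> rho_vec"

lemma star_of_rho_map_compose: "star_of_rho_map (g \<circ> f) = star_of_rho_map g \<circ> star_of_rho_map f"
  by (simp add: star_of_rho_map_def fun_eq_iff rho_vec_star_of_rho_vec)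

lemma star_of_rho_map_nth: "star_of_rho_map f y $ i = rep_rho (f (rho_vec y) $ i)"
  by (simp add: star_of_rho_map_def star_of_rho_vec_def)

lemma rho_vec_star_of_rho_map: "rho_vec (star_of_rho_map f y) = f (rho_vec y)"
  by (simp add: star_of_rho_map_def rho_vec_star_of_rho_vec)

lemma rho_C_infinity_iff:
  "f \<in> rho_C_infinity U V \<longleftrightarrow> star_of_rho_map f \<in> star_C_infinity (rho_lift U) (rho_lift V)"
proof -
  have "f ` U \<subseteq> V \<longleftrightarrow> star_of_rho_map f ` rho_lift U \<subseteq> rho_lift V"
    unfolding image_subset_iff rho_lift_iff Ball_def rho_vec_star_of_rho_map
    by (rule all_rho_vec)
  then show ?thesis
    unfolding rho_C_infinity_def star_C_infinity_def mem_Collect_eq rho_smooth_iff star_of_rho_map_nth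
    by (rule conj_cong) (rule refl)
qed

lemma rho_jacobian_eq:
  assumes "f \<in> rho_C_infinity U V" "y \<in> rho_lift U"
  shows "rho_jacobian U f (rho_vec y) =
    (\<chi> i j. rho_cls (star_jacobian (rho_lift U) (star_of_rho_map f) y $ i $ j))"
  using assms
  by (simp add: rho_jacobian_def star_jacobian_def rho_C_infinity_def rho_partial_eq
      star_of_rho_map_nth vec_eq_iff)

lemma rho_C_infinity_compose:
  assumes "f \<in> rho_C_infinity U V" "g \<in> rho_C_infinity V W"
  shows "g \<circ> f \<in> rho_C_infinity U W"
  using assms unfolding rho_C_infinity_iff star_of_rho_map_compose by (rule star_C_infinity_compose)

lemma rho_jacobian_compose:
  assumes f: "f \<in> rho_C_infinity U V" and g: "g \<in> rho_C_infinity V W" and x: "x \<in> U"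
  shows "rho_jacobian U (g \<circ> f) x = rho_jacobian V g (f x) ** rho_jacobian U f x"
proof -
  define y where "y = star_of_rho_vec x"
  let ?f = "star_of_rho_map f" and ?g = "star_of_rho_map g"
  have x_eq: "x = rho_vec y" by (simp add: y_def rho_vec_star_of_rho_vec)
  then have y: "y \<in> rho_lift U" using x by (simp add: rho_lift_iff)
  have fx: "f (rho_vec y) = rho_vec (?f y)" by (simp add: rho_vec_star_of_rho_map)
  have fy: "?f y \<in> rho_lift V"
    using f y by (auto simp: rho_C_infinity_iff star_C_infinity_def)
  have "star_jacobian (rho_lift U) (?g \<circ> ?f) y =
      star_jacobian (rho_lift V) ?g (?f y) ** star_jacobian (rho_lift U) ?f y"
    using f g y unfolding rho_C_infinity_iff by (rule star_jacobian_compose)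
  then show ?thesis
    unfolding x_eq fx rho_jacobian_eq[OF rho_C_infinity_compose[OF f g] y] rho_jacobian_eq[OF f y]
      rho_jacobian_eq[OF g fy] star_of_rho_map_compose
    by (simp add: matrix_matrix_mult_def vec_eq_iff rho_cls_sum_mult)
qed

theorem proposition3p12:
  fixes U :: "(star_real ^ 'k) set" and V :: "(star_real ^ 'l) set" and W :: "(star_real ^ 'm) set"
    and U' :: "(rho_real ^ 'k) set" and V' :: "(rho_real ^ 'l) set" and W' :: "(rho_real ^ 'm) set"
  shows "(star_open U \<and> star_open V \<and> star_open W \<longrightarrow>
      (\<lambda>(g, f). g \<circ> f) \<in> star_C_infinity V W \<times> star_C_infinity U V \<rightarrow> star_C_infinity U W \<and>
      (\<forall>f\<in>star_C_infinity U V. \<forall>g\<in>star_C_infinity V W. \<forall>x\<in>U.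
         star_jacobian U (g \<circ> f) x = star_jacobian V g (f x) ** star_jacobian U f x))
    \<and> (rho_open U' \<and> rho_open V' \<and> rho_open W' \<longrightarrow>
      (\<lambda>(g, f). g \<circ> f) \<in> rho_C_infinity V' W' \<times> rho_C_infinity U' V' \<rightarrow> rho_C_infinity U' W' \<and>
      (\<forall>f\<in>rho_C_infinity U' V'. \<forall>g\<in>rho_C_infinity V' W'. \<forall>x\<in>U'.
         rho_jacobian U' (g \<circ> f) x = rho_jacobian V' g (f x) ** rho_jacobian U' f x))"
  by (auto simp: Pi_iff star_C_infinity_compose star_jacobian_compose
      rho_C_infinity_compose rho_jacobian_compose)

end
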